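(* Assume that $A\in\mathbb R^{n\times n}$ and $B\in\mathbb R^{n\times m}$ are time independent, put $\overline B=\Phi_A(t,t+h)B=e^{-hA}B$, and assume that there exists a sequence of matrices $K_k\in\mathbb R^{m\times n}$, $k\ge1$, such that every $H_k=A-\overline BK_k$ is normal and $$\max\{\operatorname{Re}\lambda:\ \lambda\in \mathrm{Sp}(H_k)\}\le -k .$$ Let $S$ be a symmetric positive semi-definite $n\times n$ real matrix. For each $k\ge1$ let $Y_k$ be the solution of $$dY_k(t)=\big(AY_k(t)+\overline BU_k(t)\big)\,dt+\sigma(t)\,dW_t,\qquad Y_k(0)=0,$$ with the feedback control $U_k(t)=-K_kY_k(t)$. Then for all $k\ge1$ and all $t\in[0,T-h]$, $$\mathbb E\big[Y_k(t)^TSY_k(t)\big]\le\frac{\|S\|\,\|\sigma\|_\infty^2}{2k}.$$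
   Context: Let $n,m$ be positive integers, $T>0$ and $0<h<T$. Let $(\Omega,(\mathcal F_t)_{t\ge0},\mathbb P)$ be a filtered probability space carrying a one-dimensional Wiener process $W$ with respect to $(\mathcal F_t)$. $\Phi_A(t,s)$ is the fundamental matrix of $\dot x=Ax$ (here $e^{(t-s)A}$). $\mathrm{Sp}(H)$ is the spectrum of $H$; $\|S\|$ is the operator norm induced by the Euclidean norm; $\|\sigma\|_\infty$ is the essential supremum over $[0,T]$ of the Euclidean norm of $\sigma$. Standing assumptions: $\sigma\in L^\infty([0,T],\mathbb R^n)$ is deterministic, and the Gramian $G_\tau^{T+h}=\int_\tau^{T+h}\Phi_A(T+h,s)BB^T\Phi_A(T+h,s)^T\,ds$ is invertible for all $0<\tau<T+h$. *)

theory Defs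
  imports "HOL-Probability.Probability"
begin

section \<open>Matrices\<close>

text \<open>The generic exponential needs a normed algebra, which \<^typ>\<open>real^'n^'n\<close> is not (its product is
  componentwise); hence the power series with respect to the matrix product.\<close>

definition matrix_exp :: "real^'n^'n \<Rightarrow> real^'n^'n" where
  "matrix_exp A = (\<Sum>k. (1 / fact k) *\<^sub>R (((\<lambda>X. A ** X) ^^ k) (mat 1)))"

definition fundamental_matrix :: "real^'n^'n \<Rightarrow> real \<Rightarrow> real \<Rightarrow> real^'n^'n" where
  "fundamental_matrix A t s = matrix_exp ((t - s) *\<^sub>R A)"

lemma fundamental_matrix_delay: "fundamental_matrix A t (t + h) = matrix_exp (- h *\<^sub>R A)"
  by (simp add: fundamental_matrix_def)

definition gramian :: "real^'n^'n \<Rightarrow> real^'m^'n \<Rightarrow> real \<Rightarrow> real \<Rightarrow> real^'n^'n" where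
  "gramian A B \<tau> r = integral {\<tau>..r}
     (\<lambda>s. fundamental_matrix A r s ** B ** transpose B ** transpose (fundamental_matrix A r s))"

definition normal_matrix :: "real^'n^'n \<Rightarrow> bool" where
  "normal_matrix H \<longleftrightarrow> H ** transpose H = transpose H ** H"

definition matrix_spectrum :: "real^'n^'n \<Rightarrow> complex set" where
  "matrix_spectrum H = {z. \<not> invertible (mat z - (\<chi> i j. complex_of_real (H $ i $ j)))}"

definition pos_semidef :: "real^'n^'n \<Rightarrow> bool" where
  "pos_semidef S \<longleftrightarrow> transpose S = S \<and> (\<forall>x. 0 \<le> x \<bullet> (S *v x))"

section \<open>Essentially bounded functions\<close>

definition Linfty :: "real set \<Rightarrow> (real \<Rightarrow> 'b::euclidean_space) set" where
  "Linfty I = {f \<in> borel_measurable (lebesgue_on I).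
     esssup (lebesgue_on I) (\<lambda>t. ereal (norm (f t))) < \<infinity>}"

definition Linfty_norm :: "real set \<Rightarrow> (real \<Rightarrow> 'b::euclidean_space) \<Rightarrow> real" where
  "Linfty_norm I f = real_of_ereal (esssup (lebesgue_on I) (\<lambda>t. ereal (norm (f t))))"

section \<open>Filtrations and Wiener processes\<close>

text \<open>Time is \<open>[0,\<infinity>)\<close>; values of processes and filtrations at negative times are irrelevant.
  The filtration is not required to be complete or right-continuous.\<close>

locale filtered_prob_space = prob_space M for M :: "'a measure" +
  fixes F :: "real \<Rightarrow> 'a measure"
  assumes subalgebra_F: "0 \<le> t \<Longrightarrow> subalgebra M (F t)"
    and F_mono: "0 \<le> s \<Longrightarrow> s \<le> t \<Longrightarrow> subalgebra (F t) (F s)"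

locale wiener_process = filtered_prob_space M F for M :: "'a measure" and F +
  fixes W :: "real \<Rightarrow> 'a \<Rightarrow> real"
  assumes W_adapted: "0 \<le> t \<Longrightarrow> W t \<in> borel_measurable (F t)"
    and W_0: "AE \<omega> in M. W 0 \<omega> = 0"
    and W_normal: "0 \<le> s \<Longrightarrow> s < t \<Longrightarrow>
      distributed M lborel (\<lambda>\<omega>. W t \<omega> - W s \<omega>) (\<lambda>x. ennreal (normal_density 0 (sqrt (t - s)) x))"
    and W_indep: "0 \<le> s \<Longrightarrow> s < t \<Longrightarrow>
      indep_set (sets (F s)) (sets (vimage_algebra (space M) (\<lambda>\<omega>. W t \<omega> - W s \<omega>) borel))"
    and W_continuous: "AE \<omega> in M. continuous_on {0..} (\<lambda>t. W t \<omega>)"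

section \<open>The Ito integral with respect to a scalar Wiener process\<close>

text \<open>The data \<open>N\<close>, \<open>p\<close>, \<open>\<xi>\<close> stand for the process equal to \<open>\<xi> i\<close> on \<open>(p i, p (i + 1)]\<close>, \<open>i < N\<close>,
  with each \<open>\<xi> i\<close> bounded and measurable with respect to the information at time \<open>p i\<close>.\<close>

definition simple_integrand ::
    "'a measure \<Rightarrow> (real \<Rightarrow> 'a measure) \<Rightarrow> real \<Rightarrow> nat \<Rightarrow> (nat \<Rightarrow> real) \<Rightarrow>
     (nat \<Rightarrow> 'a \<Rightarrow> 'b::euclidean_space) \<Rightarrow> bool" where
  "simple_integrand M F t N p \<xi> \<longleftrightarrow>
     0 \<le> p 0 \<and> (\<forall>i<N. p i \<le> p (Suc i)) \<and> p N \<le> t \<and>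
     (\<forall>i<N. \<xi> i \<in> borel_measurable (F (p i)) \<and> (\<exists>C. \<forall>\<omega>\<in>space M. norm (\<xi> i \<omega>) \<le> C))"

definition simple_process ::
    "nat \<Rightarrow> (nat \<Rightarrow> real) \<Rightarrow> (nat \<Rightarrow> 'a \<Rightarrow> 'b::euclidean_space) \<Rightarrow> real \<Rightarrow> 'a \<Rightarrow> 'b" where
  "simple_process N p \<xi> s \<omega> = (\<Sum>i<N. indicat_real {p i<..p (Suc i)} s *\<^sub>R \<xi> i \<omega>)"

definition simple_integral ::
    "(real \<Rightarrow> 'a \<Rightarrow> real) \<Rightarrow> nat \<Rightarrow> (nat \<Rightarrow> real) \<Rightarrow> (nat \<Rightarrow> 'a \<Rightarrow> 'b::euclidean_space) \<Rightarrow> 'a \<Rightarrow> 'b" where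
  "simple_integral W N p \<xi> \<omega> = (\<Sum>i<N. (W (p (Suc i)) \<omega> - W (p i) \<omega>) *\<^sub>R \<xi> i \<omega>)"

text \<open>\<open>I\<close> is (a version of) \<open>\<integral>\<^sub>0\<^sup>t H dW\<close>: the limit in \<open>L\<^sup>2(M)\<close> of the integrals of simple processes
  that converge to \<open>H\<close> in \<open>L\<^sup>2([0,t] \<times> M)\<close>.\<close>

definition has_ito_integral ::
    "'a measure \<Rightarrow> (real \<Rightarrow> 'a measure) \<Rightarrow> (real \<Rightarrow> 'a \<Rightarrow> real) \<Rightarrow>
     (real \<Rightarrow> 'a \<Rightarrow> 'b::euclidean_space) \<Rightarrow> real \<Rightarrow> ('a \<Rightarrow> 'b) \<Rightarrow> bool" where
  "has_ito_integral M F W H t I \<longleftrightarrow>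
     (\<lambda>z. H (fst z) (snd z)) \<in> borel_measurable (lebesgue_on {0..t} \<Otimes>\<^sub>M M) \<and>
     (\<forall>s\<in>{0..t}. H s \<in> borel_measurable (F s)) \<and>
     I \<in> borel_measurable M \<and>
     (\<exists>N p \<xi>.
        (\<forall>k. simple_integrand M F t (N k) (p k) (\<xi> k)) \<and>
        (\<lambda>k. \<integral>\<^sup>+z. ennreal ((norm (H (fst z) (snd z)
                 - simple_process (N k) (p k) (\<xi> k) (fst z) (snd z)))\<^sup>2)
               \<partial>(lebesgue_on {0..t} \<Otimes>\<^sub>M M)) \<longlonglongrightarrow> 0 \<and>
        (\<lambda>k. \<integral>\<^sup>+\<omega>. ennreal ((norm (I \<omega> - simple_integral W (N k) (p k) (\<xi> k) \<omega>))\<^sup>2) \<partial>M) \<longlonglongrightarrow> 0)"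

text \<open>\<open>dY(t) = b(t) dt + g(t) dW\<^sub>t\<close> on \<open>[0,r]\<close>, \<open>Y(0) = y0\<close>.  An equation is obtained by letting
  \<open>b\<close> and \<open>g\<close> depend on \<open>Y\<close>.\<close>

definition has_stochastic_differential ::
    "'a measure \<Rightarrow> (real \<Rightarrow> 'a measure) \<Rightarrow> (real \<Rightarrow> 'a \<Rightarrow> real) \<Rightarrow> real \<Rightarrow> 'b \<Rightarrow>
     (real \<Rightarrow> 'a \<Rightarrow> 'b) \<Rightarrow> (real \<Rightarrow> 'a \<Rightarrow> 'b) \<Rightarrow> (real \<Rightarrow> 'a \<Rightarrow> 'b::euclidean_space) \<Rightarrow> bool" where
  "has_stochastic_differential M F W r y0 b g Y \<longleftrightarrow>
     (\<forall>t\<in>{0..r}. Y t \<in> borel_measurable (F t)) \<and>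
     (AE \<omega> in M. continuous_on {0..r} (\<lambda>t. Y t \<omega>)) \<and>
     (AE \<omega> in M. Y 0 \<omega> = y0) \<and>
     (AE \<omega> in M. (\<lambda>s. b s \<omega>) absolutely_integrable_on {0..r}) \<and>
     (\<forall>t\<in>{0..r}. \<exists>I. has_ito_integral M F W g t I \<and>
        (AE \<omega> in M. Y t \<omega> = Y 0 \<omega> + integral {0..t} (\<lambda>s. b s \<omega>) + I \<omega>))"

end

theory Submission
  imports Defs "HOL-Computational_Algebra.Polynomial"
begin

text \<open>Since \<open>H = A - Bbar ** K k\<close> is normal, the largest eigenvalue of its symmetric part is the real
  part of an eigenvalue of \<open>H\<close>, so the spectral bound gives \<open>x \<bullet> H x \<le> - k |x|\<^sup>2\<close>.  Instead of Ito's formula for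
  \<open>|Y|\<^sup>2\<close> or variation of constants, the solution is compared path by path with the Euler sums
  \<open>\<Sum>j<N. (1 + \<delta> H)\<^sup>N\<^sup>-\<^sup>1\<^sup>-\<^sup>j (I ((j + 1) \<delta>) - I (j \<delta>))\<close> of \<open>I \<tau> = \<integral>\<^sub>0\<^sup>\<tau> \<sigma> dW\<close>, which
  converge to \<open>Y t\<close> almost surely.  By the Ito isometry and \<open>|(1 + \<delta> H) x|\<^sup>2 \<le> (1 - 2 k \<delta> + O(\<delta>\<^sup>2)) |x|\<^sup>2\<close>
  a geometric series bounds their second moments by \<open>\<parallel>\<sigma>\<parallel>\<^sup>2 / (2 k - O(\<delta>))\<close>, and Fatou's lemma passes to
  the limit.\<close>

text \<open>The stochastic differential is available only one time at a time: each \<open>t\<close>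
  brings some version \<open>I\<close> of the integral, with its own null set and its own
  approximating simple processes, so the noise offers no path to differentiate or integrate against.
  Euler sums fit this, since they use the equation only at grid times \<open>j * (t / N)\<close>.
  Over all \<open>N\<close> these are countably many, one null set covers them, and path continuity
  enters through \<open>Y\<close> alone. The second obstacle is that the integrals at different grid
  times rest on unrelated partitions. Hence the isometry is proved for finite families of
  arbitrarily overlapping intervals, and its limit form treats linear images of integrals up to
  different times; an increment of \<open>I\<close> is a signed pair of such integrals. All second
  moments are computed in \<open>ennreal\<close>, so their finiteness comes out of the bound. The
  sharp constant \<open>2 * k\<close> survives because
  \<open>1 - \<rho> = \<delta> * (2 * k - L\<^sup>2 * \<delta>)\<close> cancels the mesh factor of
  the isometry, while the operator bound \<open>L\<close> sits only in the second-order
  term.\<close>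

section \<open>Normal matrices\<close>

text \<open>The maximiser \<open>v\<close> of the Rayleigh quotient on the compact unit sphere of
  \<open>E\<close> works: \<open>\<mu> - f\<close> is positive semidefinite on \<open>E\<close>, and
  a semidefinite form that vanishes at \<open>v\<close> has \<open>v\<close> in its kernel. The
  relative form serves two uses, one on the whole space and one on an eigenspace.\<close>

lemma symmetric_on_subspace_eigenvector:
  fixes f :: "'a::euclidean_space \<Rightarrow> 'a"
  assumes "linear f" and "subspace E" and inv: "\<And>x. x \<in> E \<Longrightarrow> f x \<in> E"
    and sym: "\<And>x y. x \<in> E \<Longrightarrow> y \<in> E \<Longrightarrow> f x \<bullet> y = x \<bullet> f y"
    and x0: "x0 \<in> E" "x0 \<noteq> 0"
  obtains v \<mu> where "v \<in> E" "norm v = 1" "f v = \<mu> *\<^sub>R v" "\<And>x. x \<in> E \<Longrightarrow> x \<bullet> f x \<le> \<mu> * (norm x)\<^sup>2"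
proof -
  interpret f: linear f by fact
  let ?S = "sphere 0 1 \<inter> E"
  have "compact ?S"
    by (intro compact_Int_closed compact_sphere closed_subspace \<open>subspace E\<close>)
  moreover have "x0 /\<^sub>R norm x0 \<in> ?S"
    using x0 \<open>subspace E\<close> by (simp add: subspace_scale)
  moreover have "continuous_on ?S (\<lambda>x. x \<bullet> f x)"
    by (intro continuous_intros linear_continuous_on linear_conv_bounded_linear[THEN iffD1] \<open>linear f\<close>)
  ultimately obtain v where v: "v \<in> ?S" and vmax: "\<And>x. x \<in> ?S \<Longrightarrow> x \<bullet> f x \<le> v \<bullet> f v"
    by (metis (no_types, lifting) continuous_attains_sup empty_iff)
  define \<mu> where "\<mu> = v \<bullet> f v"
  have v1: "norm v = 1" "v \<in> E" using v by auto
  have ray: "x \<bullet> f x \<le> \<mu> * (norm x)\<^sup>2" if "x \<in> E" for x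
  proof (cases "x = 0")
    case True then show ?thesis by (simp add: f.zero)
  next
    case False
    then have "x /\<^sub>R norm x \<in> ?S" using that \<open>subspace E\<close> by (simp add: subspace_scale)
    from vmax[OF this] show ?thesis
      using False by (simp add: f.scale \<mu>_def field_simps power2_eq_square)
  qed
  define g where "g x = \<mu> *\<^sub>R x - f x" for x
  define w where "w = g v"
  have wE: "w \<in> E" unfolding w_def g_def using v1 \<open>subspace E\<close> inv
    by (intro subspace_diff subspace_scale) auto
  have g0: "0 \<le> x \<bullet> g x" if "x \<in> E" for x
    using ray[OF that] by (simp add: g_def inner_diff_right power2_norm_eq_inner)
  have gv: "v \<bullet> w = 0"
    using v1 by (simp add: w_def g_def inner_diff_right \<mu>_def norm_eq_1)
  \<comment> \<open>Moving from \<open>v\<close> in the direction \<open>w = g v\<close> has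
    first-order effect \<open>2 * s * (w \<bullet> w)\<close>, which for small negative
    \<open>s\<close> would break semidefiniteness unless \<open>w = 0\<close>.\<close>
  have exp: "(v + s *\<^sub>R w) \<bullet> g (v + s *\<^sub>R w) = 2 * s * (w \<bullet> w) + s\<^sup>2 * (w \<bullet> g w)" for s
  proof -
    have "g (v + s *\<^sub>R w) = w + s *\<^sub>R g w"
      by (simp add: w_def g_def f.add f.scale f.diff algebra_simps)
    moreover have "v \<bullet> g w = w \<bullet> w"
    proof -
      have "v \<bullet> g w = \<mu> * (v \<bullet> w) - v \<bullet> f w" by (simp add: g_def inner_diff_right)
      also have "\<dots> = g v \<bullet> w" using sym[OF v1(2) wE] by (simp add: g_def inner_diff_left)
      finally show ?thesis by (simp add: w_def)
    qed
    ultimately show ?thesis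
      using gv by (simp add: inner_add_left inner_add_right power2_eq_square inner_commute)
  qed
  define a b where "a = w \<bullet> w" and "b = w \<bullet> g w"
  have b0: "0 \<le> b" using g0[OF wE] by (simp add: b_def)
  have "0 \<le> 2 * s * a + s\<^sup>2 * b" for s
    using g0[of "v + s *\<^sub>R w"] exp[of s] v1 wE \<open>subspace E\<close>
    by (simp add: a_def b_def subspace_add subspace_scale)
  \<comment> \<open>The quadratic in \<open>s\<close> is smallest at \<open>- a / b\<close>; the
    denominator \<open>b + 1\<close> also covers \<open>b = 0\<close> and still gives a negative
    value when \<open>a\<close> is nonzero.\<close>
  from this[of "- a / (b + 1)"] have "0 \<le> (2 * (- a / (b + 1)) * a + (- a / (b + 1))\<^sup>2 * b) * (b+1)\<^sup>2"
    using b0 by simp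
  also have "\<dots> = - (a\<^sup>2 * (b + 2))"
  proof -
    define c where "c = a / (b + 1)"
    have "a = c * (b + 1)" using b0 by (simp add: c_def)
    then have "(2 * (- c) * a + (- c)\<^sup>2 * b) * (b+1)\<^sup>2 = - (a\<^sup>2 * (b + 2))"
      by algebra
    then show ?thesis by (simp add: c_def)
  qed
  finally have "a\<^sup>2 * (b + 2) \<le> 0" by simp
  then have "a = 0" using b0 by (simp add: mult_le_0_iff)
  then have "w = 0" by (simp add: a_def)
  then have "f v = \<mu> *\<^sub>R v" by (simp add: w_def g_def)
  with v1 ray that show thesis by blast
qed

section \<open>The complex spectrum of a real matrix\<close>

definition complex_matrix :: "real^'n^'n \<Rightarrow> complex^'n^'n" where
  "complex_matrix H = (\<chi> i j. complex_of_real (H $ i $ j))"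

lemma matrix_spectrum_iff:
  fixes H :: "real^'n^'n"
  shows "z \<in> matrix_spectrum H \<longleftrightarrow> (\<exists>v. v \<noteq> 0 \<and> complex_matrix H *v v = z *s v)"
proof -
  have "z \<in> matrix_spectrum H \<longleftrightarrow> \<not> invertible (mat z - complex_matrix H)"
    unfolding matrix_spectrum_def complex_matrix_def by (rule mem_Collect_eq)
  also have "\<dots> \<longleftrightarrow> \<not> (\<forall>v. (mat z - complex_matrix H) *v v = 0 \<longrightarrow> v = 0)"
    unfolding invertible_left_inverse matrix_left_invertible_ker by (rule refl)
  also have "\<dots> \<longleftrightarrow> (\<exists>v. v \<noteq> 0 \<and> complex_matrix H *v v = z *s v)"
  proof -
    have "mat z *v v = z *s v" for v :: "complex^'n"
    proof -
      have "(\<Sum>j\<in>UNIV. (if i = j then z else 0) * v $ j) = z * v $ i" for i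
        by (subst sum.mono_neutral_right[where S = "{i}"]) auto
      then show ?thesis
        by (simp add: vec_eq_iff matrix_vector_mult_def mat_def)
    qed
    then have "(mat z - complex_matrix H) *v v = z *s v - complex_matrix H *v v" for v :: "complex^'n"
      by (simp add: matrix_vector_mult_diff_rdistrib)
    then show ?thesis by (metis right_minus_eq)
  qed
  finally show ?thesis .
qed

lemma linear_matrix_vector_mult_complex: "linear (\<lambda>v. (C::complex^'n^'m) *v v)"
proof (rule linearI)
  show "C *v (x + y) = C *v x + C *v y" for x y
    by (rule matrix_vector_right_distrib)
  show "C *v (c *\<^sub>R v) = c *\<^sub>R (C *v v)" for c v
    unfolding vec_eq_iff matrix_vector_mult_def vec_lambda_beta vector_scaleR_component
      mult_scaleR_right scaleR_sum_right by (intro allI refl)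
qed

text \<open>The spectrum is the zero set of the characteristic polynomial, written by the Leibniz
  formula over polynomial entries. Finiteness is what gives the hypothesis on \<open>Max\<close> its
  meaning, since \<open>Max\<close> says nothing about infinite sets.\<close>

lemma finite_matrix_spectrum: "finite (matrix_spectrum (H :: real^'n^'n))"
proof -
  define C where "C = complex_matrix H"
  define p where "p = (\<Sum>\<pi> | \<pi> permutes (UNIV :: 'n set). of_int (sign \<pi>) *
      (\<Prod>i\<in>UNIV. if i = \<pi> i then [: - C $ i $ \<pi> i, 1 :] else [: - C $ i $ \<pi> i :]))"
  have p: "poly p z = det (mat z - C)" for z
  proof -
    have "poly (if i = j then [: - C $ i $ j, 1 :] else [: - C $ i $ j :]) z = (mat z - C) $ i $ j" for i j
      by (simp add: mat_def)
    then show ?thesis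
      unfolding p_def det_def poly_sum poly_mult poly_prod poly_of_int by (simp only:)
  qed
  have spec: "matrix_spectrum H = {z. poly p z = 0}"
    unfolding p matrix_spectrum_def C_def complex_matrix_def invertible_det_nz not_not by (rule refl)
  obtain B where B: "\<And>v. norm (C *v v) \<le> B * norm v"
    using linear_bounded[OF linear_matrix_vector_mult_complex] by blast
  \<comment> \<open>That \<open>p\<close> is nonzero is seen by evaluation instead of from its
    leading coefficient: a number above an operator bound of \<open>C\<close> cannot be an
    eigenvalue, hence is not a root.\<close>
  have "complex_of_real (\<bar>B\<bar> + 1) \<notin> matrix_spectrum H"
  proof
    assume "complex_of_real (\<bar>B\<bar> + 1) \<in> matrix_spectrum H"
    then obtain v where v: "v \<noteq> 0" "C *v v = complex_of_real (\<bar>B\<bar> + 1) *s v"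
      unfolding matrix_spectrum_iff C_def by blast
    have "complex_of_real (\<bar>B\<bar> + 1) *s v = (\<bar>B\<bar> + 1) *\<^sub>R v"
      unfolding vec_eq_iff vector_smult_component vector_scaleR_component
      by (intro allI scaleR_conv_of_real[symmetric])
    then have "(\<bar>B\<bar> + 1) * norm v = norm (C *v v)"
      unfolding v(2) by (simp only: norm_scaleR abs_of_nonneg abs_ge_zero add_nonneg_nonneg zero_le_one)
    also have "\<dots> \<le> B * norm v" by (rule B)
    finally show False using v(1) by simp
  qed
  then have "poly p (complex_of_real (\<bar>B\<bar> + 1)) \<noteq> 0" unfolding spec mem_Collect_eq .
  then have "p \<noteq> 0" by (metis poly_0)
  then show ?thesis unfolding spec by (rule poly_roots_finite)
qed

text \<open>Split \<open>H\<close> into its symmetric part \<open>P\<close> and skew part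
  \<open>Q\<close>. Only \<open>P\<close> contributes to \<open>x \<bullet> (H *v x)\<close>, so the
  best constant is the top eigenvalue \<open>\<mu>\<close> of \<open>P\<close>. Normality says that
  \<open>P\<close> and \<open>Q\<close> commute; then \<open>Q\<close> preserves the
  \<open>\<mu>\<close>-eigenspace of \<open>P\<close>, and an eigenvalue of \<open>H\<close> with
  real part \<open>\<mu>\<close> can be found inside it.\<close>

lemma normal_matrix_rayleigh_bound:
  fixes H :: "real^'n^'n"
  assumes "normal_matrix H"
  obtains z where "z \<in> matrix_spectrum H" "\<And>x. x \<bullet> (H *v x) \<le> Re z * (norm x)\<^sup>2"
proof -
  obtain Ht where Ht: "transpose H = Ht" by blast
  define P where "P x = (1/2) *\<^sub>R (H *v x + Ht *v x)" for x
  define Q where "Q x = (1/2) *\<^sub>R (H *v x - Ht *v x)" for x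
  have linP: "linear P" and linQ: "linear Q"
    by (rule linearI; simp add: P_def Q_def matrix_vector_right_distrib matrix_vector_mult_scaleR algebra_simps)+
  interpret P: linear P by fact
  interpret Q: linear Q by fact
  have tr: "(Ht *v x) \<bullet> y = x \<bullet> (H *v y)" for x y
    by (metis Ht dot_lmul_matrix transpose_matrix_vector)
  have tr': "x \<bullet> (Ht *v y) = (H *v x) \<bullet> y" for x y
    by (metis tr inner_commute)
  have symP: "P x \<bullet> y = x \<bullet> P y" for x y
    by (simp add: P_def inner_add_left inner_add_right tr tr')
  have skewQ: "Q x \<bullet> y = - (x \<bullet> Q y)" for x y
    by (simp add: Q_def inner_diff_left inner_diff_right tr tr' field_simps)
  have HHt: "H *v (Ht *v x) = Ht *v (H *v x)" for x
    using assms by (simp add: normal_matrix_def matrix_vector_mul_assoc Ht)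
  have PQ: "P (Q x) = Q (P x)" for x
    by (simp add: P_def Q_def matrix_vector_right_distrib matrix_vector_mult_diff_distrib
        matrix_vector_mult_scaleR HHt scaleR_add_right scaleR_diff_right)
  have H: "H *v x = P x + Q x" for x
  proof -
    have "P x + Q x = (1/2) *\<^sub>R (H *v x) + (1/2) *\<^sub>R (H *v x)"
      by (simp add: P_def Q_def scaleR_add_right scaleR_diff_right)
    then show ?thesis by (simp add: scaleR_left_distrib[symmetric])
  qed
  \<comment> \<open>Any nonzero starting vector will do; index types are inhabited, so
    \<open>axis undefined 1\<close> is one.\<close>
  obtain u \<mu> where u: "norm u = 1" "P u = \<mu> *\<^sub>R u" and max: "\<And>x. x \<bullet> P x \<le> \<mu> * (norm x)\<^sup>2"
    using symmetric_on_subspace_eigenvector[of P UNIV "axis undefined 1"] linP symP by auto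
  define E where "E = {x. P x = \<mu> *\<^sub>R x}"
  have "subspace E"
    unfolding E_def subspace_def by (auto simp: P.zero P.add P.scale algebra_simps)
  have QE: "Q x \<in> E" if "x \<in> E" for x
    using that by (simp add: E_def PQ Q.scale)
  have "u \<in> E" "u \<noteq> 0" using u by (auto simp: E_def)
  \<comment> \<open>A skew map may lack real eigenvectors, but its square is symmetric, so the lemma
    on symmetric maps applies to \<open>Q \<circ> Q\<close> on \<open>E\<close>.\<close>
  obtain v \<theta> where v: "v \<in> E" "norm v = 1" and QQ: "Q (Q v) = \<theta> *\<^sub>R v"
  proof (rule symmetric_on_subspace_eigenvector[of "Q \<circ> Q" E u])
    show "linear (Q \<circ> Q)" using linQ by (rule linear_compose[OF _ linQ])
  qed (use \<open>subspace E\<close> QE \<open>u \<in> E\<close> \<open>u \<noteq> 0\<close> skewQ in auto)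
  obtain i where vi: "v $ i \<noteq> 0" using v(2) by (metis norm_zero vec_eq_iff zero_index zero_neq_one)
  have Pv: "P v = \<mu> *\<^sub>R v" and PQv: "P (Q v) = \<mu> *\<^sub>R Q v" using v QE by (auto simp: E_def)
  have "\<theta> = Q (Q v) \<bullet> v" using QQ v by (simp add: norm_eq_1)
  also have "\<dots> = - (norm (Q v))\<^sup>2" by (simp add: skewQ power2_norm_eq_inner)
  finally have lam: "\<theta> = - (norm (Q v))\<^sup>2" .
  define \<nu> where "\<nu> = norm (Q v)"
  define z where "z = Complex \<mu> \<nu>"
  have "z \<in> matrix_spectrum H"
  proof -
    txt \<open>On the eigenspace of the symmetric part, the skew part \<open>Q\<close> has \<open>Q\<^sup>2 v = - \<nu>\<^sup>2 v\<close>, so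
      \<open>\<nu> v - i Q v\<close> is a complex eigenvector; it degenerates only for \<open>\<nu> = 0\<close>, where \<open>v\<close> itself is one.\<close>
    have cm: "complex_matrix H *v (\<chi> i. Complex (a $ i) (b $ i)) = (\<chi> i. Complex ((H *v a) $ i) ((H *v b) $ i))"
      for a b :: "real^'n"
      by (simp add: vec_eq_iff matrix_vector_mult_def complex_matrix_def complex_eq_iff)
    show ?thesis
    proof (cases "\<nu> = 0")
      case True
      then have "Q v = 0" by (simp add: \<nu>_def)
      then have "H *v v = \<mu> *\<^sub>R v" by (simp add: H Pv)
      then have "complex_matrix H *v (\<chi> i. Complex (v $ i) (0 $ i)) = z *s (\<chi> i. Complex (v $ i) (0 $ i))"
        unfolding cm by (simp add: vec_eq_iff z_def True complex_eq_iff)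
      moreover have "(\<chi> i. Complex (v $ i) (0 $ i)) \<noteq> 0"
        using vi by (auto simp: vec_eq_iff complex_eq_iff)
      ultimately show ?thesis unfolding matrix_spectrum_iff by blast
    next
      case False
      have "H *v (\<nu> *\<^sub>R v) = (\<nu> * \<mu>) *\<^sub>R v + \<nu> *\<^sub>R Q v"
        by (simp add: matrix_vector_mult_scaleR H Pv algebra_simps)
      moreover have "H *v (- Q v) = (- \<mu>) *\<^sub>R Q v + (\<nu> * \<nu>) *\<^sub>R v"
        using QQ lam by (simp add: H P.neg Q.neg PQv \<nu>_def power2_eq_square)
      ultimately have "complex_matrix H *v (\<chi> i. Complex ((\<nu> *\<^sub>R v) $ i) ((- Q v) $ i)) =
          z *s (\<chi> i. Complex ((\<nu> *\<^sub>R v) $ i) ((- Q v) $ i))"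
        unfolding cm by (simp add: vec_eq_iff z_def complex_eq_iff algebra_simps)
      moreover have "(\<chi> i. Complex ((\<nu> *\<^sub>R v) $ i) ((- Q v) $ i)) \<noteq> 0"
        using vi False by (auto simp: vec_eq_iff complex_eq_iff)
      ultimately show ?thesis unfolding matrix_spectrum_iff by blast
    qed
  qed
  moreover have "x \<bullet> (H *v x) \<le> Re z * (norm x)\<^sup>2" for x
  proof -
    have "x \<bullet> Q x = 0" using skewQ[of x x] by (simp add: inner_commute)
    then show ?thesis using max[of x] by (simp add: H inner_add_right z_def)
  qed
  ultimately show thesis using that by blast
qed

lemma normal_matrix_dissipative:
  fixes H :: "real^'n^'n"
  assumes "normal_matrix H" and "Max (Re ` matrix_spectrum H) \<le> c"
  shows "x \<bullet> (H *v x) \<le> c * (norm x)\<^sup>2"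
proof -
  obtain z where z: "z \<in> matrix_spectrum H" "\<And>x. x \<bullet> (H *v x) \<le> Re z * (norm x)\<^sup>2"
    using normal_matrix_rayleigh_bound[OF assms(1)] by blast
  have "Re z \<le> Max (Re ` matrix_spectrum H)"
    using z(1) by (intro Max_ge finite_imageI finite_matrix_spectrum) simp
  with assms(2) have "Re z * (norm x)\<^sup>2 \<le> c * (norm x)\<^sup>2"
    by (intro mult_right_mono) auto
  with z(2)[of x] show ?thesis by linarith
qed

section \<open>The Ito isometry\<close>

lemma indicator_fst_measurable:
  assumes "A \<in> sets borel"
  shows "(\<lambda>z. indicator A (fst z)) \<in> borel_measurable (lebesgue_on S \<Otimes>\<^sub>M N)"
  using assms
  by (intro measurable_compose[OF measurable_fst] measurable_restrict_space1 borel_measurable_indicator) simp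

section \<open>Moments of Wiener increments and the isometry for finite sums\<close>

context wiener_process
begin

lemma measurable_F_mono:
  assumes "0 \<le> s" "s \<le> t" "f \<in> borel_measurable (F s)"
  shows "f \<in> borel_measurable (F t)"
  using measurable_from_subalg[OF F_mono] assms by blast

lemma measurable_F_M: "0 \<le> t \<Longrightarrow> f \<in> borel_measurable (F t) \<Longrightarrow> f \<in> borel_measurable M"
  using measurable_from_subalg[OF subalgebra_F] by blast

lemma W_measurable_M: "0 \<le> t \<Longrightarrow> W t \<in> borel_measurable M"
  using measurable_F_M W_adapted by blast

lemma indep_var_increment:
  fixes Z :: "'a \<Rightarrow> real"
  assumes "0 \<le> s" "s < t" and Z: "Z \<in> borel_measurable (F s)"
  shows "indep_var borel Z borel (\<lambda>\<omega>. W t \<omega> - W s \<omega>)"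
proof -
  have sub: "space (F s) = space M"
    using subalgebra_F[OF \<open>0 \<le> s\<close>] by (simp add: subalgebra_def)
  have "sigma_sets (space M) {Z -` A \<inter> space M |A. A \<in> sets borel} \<subseteq> sets (F s)"
    unfolding sub[symmetric] by (intro sets.sigma_sets_subset) (use Z in \<open>auto intro: measurable_sets\<close>)
  moreover have "sigma_sets (space M) {(\<lambda>\<omega>. W t \<omega> - W s \<omega>) -` A \<inter> space M |A. A \<in> sets borel}
      = sets (vimage_algebra (space M) (\<lambda>\<omega>. W t \<omega> - W s \<omega>) borel)"
    by (simp add: sets_vimage_algebra)
  ultimately have "indep_set (sigma_sets (space M) {Z -` A \<inter> space M |A. A \<in> sets borel})
      (sigma_sets (space M) {(\<lambda>\<omega>. W t \<omega> - W s \<omega>) -` A \<inter> space M |A. A \<in> sets borel})"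
    using W_indep[OF assms(1,2)] unfolding indep_set_def
    by (elim indep_sets_mono_sets) (auto split: bool.split)
  moreover have "Z \<in> borel_measurable M" "(\<lambda>\<omega>. W t \<omega> - W s \<omega>) \<in> borel_measurable M"
    using measurable_F_M[OF assms(1) Z] W_measurable_M assms by auto
  ultimately show ?thesis unfolding indep_var_eq by blast
qed

lemma increment_integrable:
  assumes "0 \<le> s" "s \<le> t"
  shows "integrable M (\<lambda>\<omega>. W t \<omega> - W s \<omega>)" "integrable M (\<lambda>\<omega>. (W t \<omega> - W s \<omega>)\<^sup>2)"
    and "expectation (\<lambda>\<omega>. W t \<omega> - W s \<omega>) = 0" "expectation (\<lambda>\<omega>. (W t \<omega> - W s \<omega>)\<^sup>2) = t - s"
proof -
  have "integrable M (\<lambda>\<omega>. W t \<omega> - W s \<omega>) \<and> integrable M (\<lambda>\<omega>. (W t \<omega> - W s \<omega>)\<^sup>2)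
    \<and> expectation (\<lambda>\<omega>. W t \<omega> - W s \<omega>) = 0 \<and> expectation (\<lambda>\<omega>. (W t \<omega> - W s \<omega>)\<^sup>2) = t - s"
  \<comment> \<open>The normal law is given only for \<open>s < t\<close>; a degenerate interval has
    zero increment, and partitions may contain such intervals.\<close>
  proof (cases "s = t")
    case False
    with assms have st: "s < t" by simp
    note D = W_normal[OF \<open>0 \<le> s\<close> st]
    have pos: "0 < sqrt (t - s)" using st by simp
    have "integrable M (\<lambda>\<omega>. (W t \<omega> - W s \<omega>)^k)" for k
      using distributed_integrable[OF D, of "\<lambda>x. x^k"] integrable_normal_moment[OF pos, of 0 k] by simp
    from this[of 1] this[of 2] have
      "integrable M (\<lambda>\<omega>. W t \<omega> - W s \<omega>)" "integrable M (\<lambda>\<omega>. (W t \<omega> - W s \<omega>)\<^sup>2)" by simp_all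
    moreover have "expectation (\<lambda>\<omega>. W t \<omega> - W s \<omega>) = 0"
      by (rule normal_distributed_expectation[OF pos D])
    moreover have "variance (\<lambda>\<omega>. W t \<omega> - W s \<omega>) = (sqrt (t - s))\<^sup>2"
      by (rule normal_distributed_variance[OF pos D])
    ultimately show ?thesis using st by simp
  qed simp
  then show "integrable M (\<lambda>\<omega>. W t \<omega> - W s \<omega>)" "integrable M (\<lambda>\<omega>. (W t \<omega> - W s \<omega>)\<^sup>2)"
    and "expectation (\<lambda>\<omega>. W t \<omega> - W s \<omega>) = 0" "expectation (\<lambda>\<omega>. (W t \<omega> - W s \<omega>)\<^sup>2) = t - s"
    by blast+
qed

text \<open>The martingale property and the conditional variance of \<open>W\<close> in integrated
  form: a weight known at time \<open>s\<close> is independent of the increment, so the expectation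
  factors.\<close>

lemma has_bochner_integral_mult_increment:
  fixes Z :: "'a \<Rightarrow> real"
  assumes "0 \<le> s" "s \<le> t" and Z: "Z \<in> borel_measurable (F s)" "integrable M Z"
  shows "has_bochner_integral M (\<lambda>\<omega>. Z \<omega> * (W t \<omega> - W s \<omega>)) 0"
    and "has_bochner_integral M (\<lambda>\<omega>. Z \<omega> * (W t \<omega> - W s \<omega>)\<^sup>2) ((t - s) * expectation Z)"
proof -
  note I = increment_integrable[OF assms(1,2)]
  have "has_bochner_integral M (\<lambda>\<omega>. Z \<omega> * (W t \<omega> - W s \<omega>)) 0 \<and>
    has_bochner_integral M (\<lambda>\<omega>. Z \<omega> * (W t \<omega> - W s \<omega>)\<^sup>2) ((t - s) * expectation Z)"
  proof (cases "s = t")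
    case True then show ?thesis by (simp add: has_bochner_integral_zero)
  next
    case False
    then have ind: "indep_var borel Z borel (\<lambda>\<omega>. W t \<omega> - W s \<omega>)"
      using indep_var_increment assms by simp
    have ind2: "indep_var borel Z borel (\<lambda>\<omega>. (W t \<omega> - W s \<omega>)\<^sup>2)"
      using indep_var_compose[OF ind, of "\<lambda>x. x" borel "\<lambda>x. x\<^sup>2" borel] by (simp add: comp_def)
    show ?thesis
      using indep_var_integrable[OF ind Z(2) I(1)] indep_var_lebesgue_integral[OF ind Z(2) I(1)]
        indep_var_integrable[OF ind2 Z(2) I(2)] indep_var_lebesgue_integral[OF ind2 Z(2) I(2)]
      by (simp add: has_bochner_integral_iff I)
  qed
  then show "has_bochner_integral M (\<lambda>\<omega>. Z \<omega> * (W t \<omega> - W s \<omega>)) 0"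
    "has_bochner_integral M (\<lambda>\<omega>. Z \<omega> * (W t \<omega> - W s \<omega>)\<^sup>2) ((t - s) * expectation Z)" by blast+
qed

text \<open>The earlier increment is absorbed into the weight: \<open>Z * (W b - W a)\<close> is
  known at time \<open>c\<close>, and it is integrable because \<open>Z\<close> is bounded, so the
  centred later increment annihilates it.\<close>

lemma has_bochner_integral_increment_increment:
  fixes Z :: "'a \<Rightarrow> real"
  assumes "0 \<le> a" "a \<le> b" "b \<le> c" "c \<le> d" and Z: "Z \<in> borel_measurable (F c)"
    and bdd: "\<And>\<omega>. \<omega> \<in> space M \<Longrightarrow> \<bar>Z \<omega>\<bar> \<le> C"
  shows "has_bochner_integral M (\<lambda>\<omega>. Z \<omega> * ((W b \<omega> - W a \<omega>) * (W d \<omega> - W c \<omega>))) 0"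
proof -
  have "W a \<in> borel_measurable (F c)" "W b \<in> borel_measurable (F c)"
    using measurable_F_mono[of a c, OF _ _ W_adapted[of a]] measurable_F_mono[of b c, OF _ _ W_adapted[of b]] assms
    by auto
  with Z have m: "(\<lambda>\<omega>. Z \<omega> * (W b \<omega> - W a \<omega>)) \<in> borel_measurable (F c)" by simp
  have "0 \<le> c" using assms by simp
  have "integrable M (\<lambda>\<omega>. Z \<omega> * (W b \<omega> - W a \<omega>))"
  proof (rule Bochner_Integration.integrable_bound)
    show "integrable M (\<lambda>\<omega>. C * (W b \<omega> - W a \<omega>))"
      using increment_integrable(1)[OF assms(1,2)] by simp
    show "(\<lambda>\<omega>. Z \<omega> * (W b \<omega> - W a \<omega>)) \<in> borel_measurable M"
      by (rule measurable_F_M[OF \<open>0 \<le> c\<close> m])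
    show "AE \<omega> in M. norm (Z \<omega> * (W b \<omega> - W a \<omega>)) \<le> norm (C * (W b \<omega> - W a \<omega>))"
    proof (rule AE_I2)
      fix \<omega> assume "\<omega> \<in> space M"
      then have "\<bar>Z \<omega>\<bar> \<le> \<bar>C\<bar>" using bdd[of \<omega>] by linarith
      then show "norm (Z \<omega> * (W b \<omega> - W a \<omega>)) \<le> norm (C * (W b \<omega> - W a \<omega>))"
        by (simp add: abs_mult mult_right_mono)
    qed
  qed
  from has_bochner_integral_mult_increment(1)[OF \<open>0 \<le> c\<close> \<open>c \<le> d\<close> m this]
  show ?thesis by (simp add: mult.assoc)
qed

text \<open>For overlapping intervals, cut at \<open>c\<close>, at the smaller right end
  \<open>m\<close> and at the larger one \<open>M'\<close>. The product becomes the square over the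
  overlap \<open>(c, m]\<close> plus two products of increments over successive intervals; only the
  square contributes.\<close>

lemma has_bochner_integral_increment_product_aux:
  fixes Z :: "'a \<Rightarrow> real"
  assumes "0 \<le> a" "a \<le> b" "a \<le> c" "c \<le> d" and Z: "Z \<in> borel_measurable (F c)"
    and bdd: "\<And>\<omega>. \<omega> \<in> space M \<Longrightarrow> \<bar>Z \<omega>\<bar> \<le> C"
  shows "has_bochner_integral M (\<lambda>\<omega>. Z \<omega> * ((W b \<omega> - W a \<omega>) * (W d \<omega> - W c \<omega>)))
    (max 0 (min b d - c) * expectation Z)"
proof (cases "b \<le> c")
  case True
  then have "max 0 (min b d - c) = 0" by simp
  then show ?thesis
    using has_bochner_integral_increment_increment[OF assms(1,2) True assms(4) Z bdd] by simp
next
  case False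
  have c0: "0 \<le> c" using assms by simp
  have intZ: "integrable M Z"
    by (rule integrable_const_bound[where B = C]) (use bdd measurable_F_M[OF c0 Z] in auto)
  define m M' where "m = min b d" and "M' = max b d"
  have cm: "c \<le> m" "m \<le> M'" using False assms by (auto simp: m_def M'_def)
  have "Z \<in> borel_measurable (F m)" using measurable_F_mono[OF c0 cm(1) Z] .
  then have "has_bochner_integral M (\<lambda>\<omega>. Z \<omega> * ((W c \<omega> - W a \<omega>) * (W d \<omega> - W c \<omega>))
      + Z \<omega> * (W m \<omega> - W c \<omega>)\<^sup>2 + Z \<omega> * ((W m \<omega> - W c \<omega>) * (W M' \<omega> - W m \<omega>)))
      (0 + (m - c) * expectation Z + 0)"
    by (intro has_bochner_integral_add
          has_bochner_integral_increment_increment[OF assms(1,3) order.refl assms(4) Z bdd]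
          has_bochner_integral_mult_increment(2)[OF c0 cm(1) Z intZ]
          has_bochner_integral_increment_increment[OF c0 cm(1) order.refl cm(2) _ bdd])
  moreover have "Z \<omega> * ((W c \<omega> - W a \<omega>) * (W d \<omega> - W c \<omega>))
      + Z \<omega> * (W m \<omega> - W c \<omega>)\<^sup>2 + Z \<omega> * ((W m \<omega> - W c \<omega>) * (W M' \<omega> - W m \<omega>))
      = Z \<omega> * ((W b \<omega> - W a \<omega>) * (W d \<omega> - W c \<omega>))" for \<omega>
    by (cases "b \<le> d") (simp_all add: m_def M'_def algebra_simps power2_eq_square)
  ultimately show ?thesis using cm by (simp add: m_def)
qed

lemma has_bochner_integral_increment_product:
  fixes Z :: "'a \<Rightarrow> real"
  assumes "0 \<le> a" "a \<le> b" "0 \<le> c" "c \<le> d" and Z: "Z \<in> borel_measurable (F (max a c))"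
    and bdd: "\<And>\<omega>. \<omega> \<in> space M \<Longrightarrow> \<bar>Z \<omega>\<bar> \<le> C"
  shows "has_bochner_integral M (\<lambda>\<omega>. Z \<omega> * ((W b \<omega> - W a \<omega>) * (W d \<omega> - W c \<omega>)))
    (max 0 (min b d - max a c) * expectation Z)"
proof (cases "a \<le> c")
  case True
  then show ?thesis
    using has_bochner_integral_increment_product_aux[OF assms(1,2) True assms(4) _ bdd] Z by (simp add: max_absorb2)
next
  case False
  then have "c \<le> a" by simp
  with has_bochner_integral_increment_product_aux[OF assms(3,4) this assms(2) _ bdd] Z show ?thesis
    by (simp add: max_absorb1 min.commute mult.commute)
qed

text \<open>The intervals may overlap in any way, so sums over different partitions need no common
  refinement. Both sides expand into the same double sum: the overlap length of two intervals times
  the mean of \<open>\<xi> i \<bullet> \<xi> j\<close>.\<close>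

lemma elementary_ito_isometry:
  fixes \<xi> :: "'i \<Rightarrow> 'a \<Rightarrow> 'b::euclidean_space"
  assumes "finite I" and a: "\<And>i. i \<in> I \<Longrightarrow> 0 \<le> a i" and ab: "\<And>i. i \<in> I \<Longrightarrow> a i \<le> b i"
    and bt: "\<And>i. i \<in> I \<Longrightarrow> b i \<le> t" and \<xi>: "\<And>i. i \<in> I \<Longrightarrow> \<xi> i \<in> borel_measurable (F (a i))"
    and bdd: "\<And>i \<omega>. i \<in> I \<Longrightarrow> \<omega> \<in> space M \<Longrightarrow> norm (\<xi> i \<omega>) \<le> C i"
  shows "(\<integral>\<^sup>+\<omega>. ennreal ((norm (\<Sum>i\<in>I. (W (b i) \<omega> - W (a i) \<omega>) *\<^sub>R \<xi> i \<omega>))\<^sup>2) \<partial>M) =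
    (\<integral>\<^sup>+z. ennreal ((norm (\<Sum>i\<in>I. indicat_real {a i<..b i} (fst z) *\<^sub>R \<xi> i (snd z)))\<^sup>2)
      \<partial>(lebesgue_on {0..t} \<Otimes>\<^sub>M M))"
proof -
  let ?L = "lebesgue_on {0..t}"
  define ov where "ov i j = max 0 (min (b i) (b j) - max (a i) (a j))" for i j
  define e where "e i j = expectation (\<lambda>\<omega>. \<xi> i \<omega> \<bullet> \<xi> j \<omega>)" for i j
  have norm_sum: "(norm (\<Sum>i\<in>I. f i *\<^sub>R x i))\<^sup>2 = (\<Sum>i\<in>I. \<Sum>j\<in>I. (x i \<bullet> x j) * (f i * f j))"
    for f :: "'i \<Rightarrow> real" and x :: "'i \<Rightarrow> 'b"
    by (simp add: power2_norm_eq_inner inner_sum_left inner_sum_right sum_distrib_left mult_ac inner_commute)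
  have C0: "0 \<le> C i" if "i \<in> I" for i
  proof -
    obtain \<omega> where "\<omega> \<in> space M" using not_empty by blast
    from bdd[OF that this] show ?thesis by (meson norm_ge_zero order_trans)
  qed
  have bdd2: "\<bar>\<xi> i \<omega> \<bullet> \<xi> j \<omega>\<bar> \<le> C i * C j" if "i \<in> I" "j \<in> I" "\<omega> \<in> space M" for i j \<omega>
  proof -
    have "\<bar>\<xi> i \<omega> \<bullet> \<xi> j \<omega>\<bar> \<le> norm (\<xi> i \<omega>) * norm (\<xi> j \<omega>)" by (rule Cauchy_Schwarz_ineq2)
    also have "\<dots> \<le> C i * C j" using that bdd C0 by (intro mult_mono) auto
    finally show ?thesis .
  qed
  \<comment> \<open>Both factors are known at the later left endpoint, which is also where the
    overlap of the two intervals starts.\<close>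
  have m: "(\<lambda>\<omega>. \<xi> i \<omega> \<bullet> \<xi> j \<omega>) \<in> borel_measurable (F (max (a i) (a j)))" if "i \<in> I" "j \<in> I" for i j
    using measurable_F_mono[OF a _ \<xi>, of i "max (a i) (a j)"] measurable_F_mono[OF a _ \<xi>, of j "max (a i) (a j)"] that
    by (intro borel_measurable_inner) auto
  have \<xi>M[measurable]: "\<xi> i \<in> borel_measurable M" if "i \<in> I" for i
    using measurable_F_M[OF a \<xi>] that by blast
  have inte: "has_bochner_integral M (\<lambda>\<omega>. \<xi> i \<omega> \<bullet> \<xi> j \<omega>) (e i j)" if "i \<in> I" "j \<in> I" for i j
    unfolding e_def has_bochner_integral_iff
    by (intro conjI refl integrable_const_bound[where B = "C i * C j"])
      (use bdd2 \<xi>M that in auto)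
  have "has_bochner_integral M (\<lambda>\<omega>. (norm (\<Sum>i\<in>I. (W (b i) \<omega> - W (a i) \<omega>) *\<^sub>R \<xi> i \<omega>))\<^sup>2)
      (\<Sum>i\<in>I. \<Sum>j\<in>I. ov i j * e i j)"
    unfolding norm_sum ov_def e_def
    by (intro has_bochner_integral_sum has_bochner_integral_increment_product) (use a ab m bdd2 in auto)
  then have E: "(\<integral>\<^sup>+\<omega>. ennreal ((norm (\<Sum>i\<in>I. (W (b i) \<omega> - W (a i) \<omega>) *\<^sub>R \<xi> i \<omega>))\<^sup>2) \<partial>M)
      = ennreal (\<Sum>i\<in>I. \<Sum>j\<in>I. ov i j * e i j)"
    by (subst nn_integral_eq_integral) (auto simp: has_bochner_integral_iff)
  define g where "g s = (\<Sum>i\<in>I. \<Sum>j\<in>I. e i j * (indicat_real {a i<..b i} s * indicat_real {a j<..b j} s))" for s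
  have hg: "has_bochner_integral M (\<lambda>\<omega>. (norm (\<Sum>i\<in>I. indicat_real {a i<..b i} s *\<^sub>R \<xi> i \<omega>))\<^sup>2) (g s)" for s
    unfolding norm_sum g_def
    by (intro has_bochner_integral_sum has_bochner_integral_mult_left inte)
  have g0: "0 \<le> g s" for s
    using hg[of s] by (metis (no_types, lifting) Bochner_Integration.integral_nonneg has_bochner_integral_integral_eq zero_le_power2)
  have nng: "(\<integral>\<^sup>+\<omega>. ennreal ((norm (\<Sum>i\<in>I. indicat_real {a i<..b i} s *\<^sub>R \<xi> i \<omega>))\<^sup>2) \<partial>M) = ennreal (g s)" for s
    using hg[of s] by (subst nn_integral_eq_integral) (auto simp: has_bochner_integral_iff)
  have ind: "has_bochner_integral ?L (\<lambda>s. indicat_real {a i<..b i} s * indicat_real {a j<..b j} s) (ov i j)"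
    if "i \<in> I" "j \<in> I" for i j
  proof -
    define A where "A = {max (a i) (a j)<..min (b i) (b j)}"
    have eq: "indicat_real {a i<..b i} s * indicat_real {a j<..b j} s = indicat_real A s" for s
      by (auto simp: A_def indicator_def)
    have sub: "A \<subseteq> {0..t}" using a[OF that(1)] bt[OF that(1)] by (auto simp: A_def)
    then have sets: "A \<in> sets ?L" by (simp add: A_def sets_restrict_space_iff)
    have em: "emeasure ?L A = emeasure lborel A"
      using sub by (subst emeasure_restrict_space) (auto simp: A_def)
    then have "emeasure ?L A = ennreal (ov i j)"
      by (cases "max (a i) (a j) \<le> min (b i) (b j)") (auto simp: A_def ov_def max_def)
    moreover have "0 \<le> ov i j" by (simp add: ov_def)
    ultimately have "emeasure ?L A < \<infinity>" "measure ?L A = ov i j"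
      by (simp_all add: measure_def)
    with has_bochner_integral_real_indicator[OF sets] show ?thesis unfolding eq by simp
  qed
  have "has_bochner_integral ?L g (\<Sum>i\<in>I. \<Sum>j\<in>I. e i j * ov i j)"
    unfolding g_def
    by (intro has_bochner_integral_sum has_bochner_integral_mult_right ind)
  then have R: "(\<integral>\<^sup>+s. ennreal (g s) \<partial>?L) = ennreal (\<Sum>i\<in>I. \<Sum>j\<in>I. e i j * ov i j)"
    by (subst nn_integral_eq_integral) (auto simp: has_bochner_integral_iff g0)
  have "(\<lambda>z. (norm (\<Sum>i\<in>I. indicat_real {a i<..b i} (fst z) *\<^sub>R \<xi> i (snd z)))\<^sup>2) \<in> borel_measurable (?L \<Otimes>\<^sub>M M)"
  proof -
    have "(\<lambda>z. indicat_real {a i<..b i} (fst z)) \<in> borel_measurable (?L \<Otimes>\<^sub>M M)" for i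
      by (rule indicator_fst_measurable) simp
    moreover have "(\<lambda>z. \<xi> i (snd z)) \<in> borel_measurable (?L \<Otimes>\<^sub>M M)" if "i \<in> I" for i
      by (rule measurable_compose[OF measurable_snd \<xi>M[OF that]])
    ultimately show ?thesis
      by (intro borel_measurable_power measurable_compose[OF _ borel_measurable_norm]
          borel_measurable_sum borel_measurable_scaleR)
  qed
  then have "(\<integral>\<^sup>+z. ennreal ((norm (\<Sum>i\<in>I. indicat_real {a i<..b i} (fst z) *\<^sub>R \<xi> i (snd z)))\<^sup>2)
      \<partial>(?L \<Otimes>\<^sub>M M)) = (\<integral>\<^sup>+s. ennreal (g s) \<partial>?L)"
    by (subst nn_integral_fst[symmetric]) (simp_all add: nng)
  then show ?thesis unfolding E R by (simp add: mult.commute)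
qed

end

section \<open>Mean-square limits\<close>

lemma power2_norm_add_le:
  fixes x y :: "'b::real_inner"
  assumes "0 < \<epsilon>"
  shows "(norm (x + y))\<^sup>2 \<le> (1 + \<epsilon>) * (norm x)\<^sup>2 + (1 + 1 / \<epsilon>) * (norm y)\<^sup>2"
proof -
  \<comment> \<open>Young's inequality, read off from a square. The free \<open>\<epsilon>\<close>
    lets the factor of \<open>(norm x)\<^sup>2\<close> come arbitrarily close to 1.\<close>
  have "0 \<le> (sqrt \<epsilon> * norm x - norm y / sqrt \<epsilon>)\<^sup>2" by simp
  also have "\<dots> = \<epsilon> * (norm x)\<^sup>2 - 2 * (norm x * norm y) + (norm y)\<^sup>2 / \<epsilon>"
    using assms by (simp add: power2_diff power_mult_distrib power_divide)
  finally have *: "2 * (norm x * norm y) \<le> \<epsilon> * (norm x)\<^sup>2 + (norm y)\<^sup>2 / \<epsilon>" by simp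
  have "(norm (x + y))\<^sup>2 \<le> (norm x + norm y)\<^sup>2"
    by (intro power_mono norm_triangle_ineq) simp
  also have "\<dots> \<le> (1 + \<epsilon>) * (norm x)\<^sup>2 + (1 + 1 / \<epsilon>) * (norm y)\<^sup>2"
    using * by (simp add: power2_sum algebra_simps)
  finally show ?thesis .
qed

lemma nn_integral_power2_norm_le:
  fixes f g :: "'a \<Rightarrow> 'b::euclidean_space"
  assumes [measurable]: "f \<in> borel_measurable M" "g \<in> borel_measurable M" and "0 < \<epsilon>"
  shows "(\<integral>\<^sup>+x. ennreal ((norm (f x))\<^sup>2) \<partial>M) \<le>
    ennreal (1 + \<epsilon>) * (\<integral>\<^sup>+x. ennreal ((norm (g x))\<^sup>2) \<partial>M) +
    ennreal (1 + 1 / \<epsilon>) * (\<integral>\<^sup>+x. ennreal ((norm (f x - g x))\<^sup>2) \<partial>M)"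
proof -
  have "(\<integral>\<^sup>+x. ennreal ((norm (f x))\<^sup>2) \<partial>M) \<le>
      (\<integral>\<^sup>+x. ennreal (1 + \<epsilon>) * ennreal ((norm (g x))\<^sup>2) + ennreal (1 + 1 / \<epsilon>) * ennreal ((norm (f x - g x))\<^sup>2) \<partial>M)"
  proof (rule nn_integral_mono)
    fix x
    have "ennreal ((norm (f x))\<^sup>2) \<le> ennreal ((1 + \<epsilon>) * (norm (g x))\<^sup>2 + (1 + 1 / \<epsilon>) * (norm (f x - g x))\<^sup>2)"
      using power2_norm_add_le[OF \<open>0 < \<epsilon>\<close>, of "g x" "f x - g x"] by (intro ennreal_leI) simp
    also have "\<dots> = ennreal (1 + \<epsilon>) * ennreal ((norm (g x))\<^sup>2) + ennreal (1 + 1 / \<epsilon>) * ennreal ((norm (f x - g x))\<^sup>2)"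
      using \<open>0 < \<epsilon>\<close> by (simp add: ennreal_plus[symmetric] ennreal_mult[symmetric] del: ennreal_plus)
    finally show "ennreal ((norm (f x))\<^sup>2) \<le> \<dots>" .
  qed
  also have "\<dots> = ennreal (1 + \<epsilon>) * (\<integral>\<^sup>+x. ennreal ((norm (g x))\<^sup>2) \<partial>M) +
    ennreal (1 + 1 / \<epsilon>) * (\<integral>\<^sup>+x. ennreal ((norm (f x - g x))\<^sup>2) \<partial>M)"
    by (simp add: nn_integral_add nn_integral_cmult)
  finally show ?thesis .
qed

text \<open>Compare \<open>X\<close> with \<open>Xs k\<close>, transfer the norm by
  \<open>eq\<close>, then compare \<open>Vs k\<close> with \<open>V\<close>. Each comparison costs a
  factor \<open>1 + \<epsilon>\<close> and an error that vanishes with \<open>k\<close>;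
  \<open>\<epsilon>\<close> goes to 0 last. The two measures differ because one side lives on the
  probability space and the other on the product with time.\<close>

lemma nn_integral_power2_norm_L2_limit_le:
  fixes X :: "'a \<Rightarrow> 'b::euclidean_space" and V :: "'c \<Rightarrow> 'd::euclidean_space"
  assumes [measurable]: "X \<in> borel_measurable M" "\<And>k. Xs k \<in> borel_measurable M"
    "V \<in> borel_measurable N" "\<And>k. Vs k \<in> borel_measurable N"
    and X: "(\<lambda>k. \<integral>\<^sup>+x. ennreal ((norm (X x - Xs k x))\<^sup>2) \<partial>M) \<longlonglongrightarrow> 0"
    and V: "(\<lambda>k. \<integral>\<^sup>+x. ennreal ((norm (V x - Vs k x))\<^sup>2) \<partial>N) \<longlonglongrightarrow> 0"
    and eq: "\<And>k. (\<integral>\<^sup>+x. ennreal ((norm (Xs k x))\<^sup>2) \<partial>M) = (\<integral>\<^sup>+x. ennreal ((norm (Vs k x))\<^sup>2) \<partial>N)"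
  shows "(\<integral>\<^sup>+x. ennreal ((norm (X x))\<^sup>2) \<partial>M) \<le> (\<integral>\<^sup>+x. ennreal ((norm (V x))\<^sup>2) \<partial>N)"
    (is "?X \<le> ?V")
proof -
  have eps: "?X \<le> ennreal (1 + \<epsilon>) * (ennreal (1 + \<epsilon>) * ?V)" if e: "0 < \<epsilon>" for \<epsilon>
  proof -
    let ?b = "\<lambda>k. ennreal (1 + \<epsilon>) * (ennreal (1 + \<epsilon>) * ?V
          + ennreal (1 + 1 / \<epsilon>) * (\<integral>\<^sup>+x. ennreal ((norm (V x - Vs k x))\<^sup>2) \<partial>N))
        + ennreal (1 + 1 / \<epsilon>) * (\<integral>\<^sup>+x. ennreal ((norm (X x - Xs k x))\<^sup>2) \<partial>M)"
    have "?X \<le> ?b k" for k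
    proof -
      have "?X \<le> ennreal (1 + \<epsilon>) * (\<integral>\<^sup>+x. ennreal ((norm (Xs k x))\<^sup>2) \<partial>M)
          + ennreal (1 + 1 / \<epsilon>) * (\<integral>\<^sup>+x. ennreal ((norm (X x - Xs k x))\<^sup>2) \<partial>M)"
        by (rule nn_integral_power2_norm_le[OF _ _ e]) measurable
      also have "\<dots> \<le> ?b k"
        unfolding eq norm_minus_commute[of "V _"]
        by (intro add_mono mult_left_mono nn_integral_power2_norm_le[OF _ _ e] order.refl) simp_all
      finally show ?thesis .
    qed
    moreover have "?b \<longlonglongrightarrow> ennreal (1 + \<epsilon>) * (ennreal (1 + \<epsilon>) * ?V + ennreal (1 + 1 / \<epsilon>) * 0) + ennreal (1 + 1 / \<epsilon>) * 0"
      by (intro tendsto_add ennreal_tendsto_cmult X V tendsto_const) auto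
    ultimately show ?thesis by (intro LIMSEQ_le_const) auto
  qed
  show ?thesis
  proof (cases "?V = \<infinity>")
    case False
    \<comment> \<open>With \<open>\<epsilon> = 1 / (n + 1)\<close> the squared factor tends to 1.
      Multiplication by \<open>?V\<close> passes to the limit because \<open>?V\<close> is finite in
      this case.\<close>
    have "(\<lambda>n. ?V * ennreal ((1 + 1 / real (Suc n)) * (1 + 1 / real (Suc n)))) \<longlonglongrightarrow> ?V * ennreal ((1 + 0) * (1 + 0))"
      by (intro ennreal_tendsto_cmult tendsto_ennrealI tendsto_mult tendsto_add tendsto_const LIMSEQ_Suc[OF lim_1_over_n])
        (use False in \<open>auto simp: top.not_eq_extremum\<close>)
    moreover have "?X \<le> ?V * ennreal ((1 + 1 / real (Suc n)) * (1 + 1 / real (Suc n)))" for n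
      using eps[of "1 / real (Suc n)"] by (simp add: ennreal_mult mult_ac)
    ultimately show ?thesis by (intro LIMSEQ_le_const[of _ ?V]) auto
  qed simp
qed

text \<open>Cauchy-Schwarz over the finite index set and the operator norms of the
  \<open>Q j\<close> dominate the squared norm by a fixed combination of the individual ones. This
  controls the approximation errors of several Ito integrals at once.\<close>

lemma tendsto_nn_integral_power2_norm_linear_sum:
  fixes f :: "'j \<Rightarrow> nat \<Rightarrow> 'a \<Rightarrow> 'b::euclidean_space" and Q :: "'j \<Rightarrow> 'b \<Rightarrow> 'd::euclidean_space"
  assumes "finite J" and lin: "\<And>j. j \<in> J \<Longrightarrow> linear (Q j)"
    and meas: "\<And>j k. j \<in> J \<Longrightarrow> f j k \<in> borel_measurable M"
    and lim: "\<And>j. j \<in> J \<Longrightarrow> (\<lambda>k. \<integral>\<^sup>+x. ennreal ((norm (f j k x))\<^sup>2) \<partial>M) \<longlonglongrightarrow> 0"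
  shows "(\<lambda>k. \<integral>\<^sup>+x. ennreal ((norm (\<Sum>j\<in>J. Q j (f j k x)))\<^sup>2) \<partial>M) \<longlonglongrightarrow> 0"
proof -
  define B where "B j = onorm (Q j)" for j
  have B: "norm (Q j x) \<le> B j * norm x" if "j \<in> J" for j x
    unfolding B_def by (rule onorm) (use lin[OF that] in \<open>simp add: linear_conv_bounded_linear\<close>)
  have le: "(norm (\<Sum>j\<in>J. Q j (f j k x)))\<^sup>2 \<le> (\<Sum>j\<in>J. real (card J) * (B j)\<^sup>2 * (norm (f j k x))\<^sup>2)" for k x
  proof -
    have "(norm (\<Sum>j\<in>J. Q j (f j k x)))\<^sup>2 \<le> (\<Sum>j\<in>J. norm (Q j (f j k x)))\<^sup>2"
      by (intro power_mono norm_sum) simp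
    also have "\<dots> \<le> (\<Sum>j\<in>J. (norm (Q j (f j k x)))\<^sup>2) * real (card J)"
      by (rule sum_squared_le_sum_of_squares)
    also have "\<dots> \<le> (\<Sum>j\<in>J. (B j * norm (f j k x))\<^sup>2) * real (card J)"
      by (intro mult_right_mono sum_mono power_mono B) auto
    finally show ?thesis unfolding power_mult_distrib sum_distrib_right by (simp only: mult_ac)
  qed
  have ub: "(\<integral>\<^sup>+x. ennreal ((norm (\<Sum>j\<in>J. Q j (f j k x)))\<^sup>2) \<partial>M) \<le>
      (\<Sum>j\<in>J. ennreal (real (card J) * (B j)\<^sup>2) * (\<integral>\<^sup>+x. ennreal ((norm (f j k x))\<^sup>2) \<partial>M))" for k
  proof -
    have "(\<integral>\<^sup>+x. ennreal ((norm (\<Sum>j\<in>J. Q j (f j k x)))\<^sup>2) \<partial>M) \<le>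
        (\<integral>\<^sup>+x. (\<Sum>j\<in>J. ennreal (real (card J) * (B j)\<^sup>2) * ennreal ((norm (f j k x))\<^sup>2)) \<partial>M)"
    proof (rule nn_integral_mono)
      fix x
      have "ennreal ((norm (\<Sum>j\<in>J. Q j (f j k x)))\<^sup>2) \<le> ennreal (\<Sum>j\<in>J. real (card J) * (B j)\<^sup>2 * (norm (f j k x))\<^sup>2)"
        using le by (rule ennreal_leI)
      also have "\<dots> = (\<Sum>j\<in>J. ennreal (real (card J) * (B j)\<^sup>2) * ennreal ((norm (f j k x))\<^sup>2))"
        unfolding ennreal_mult[OF mult_nonneg_nonneg[OF of_nat_0_le_iff zero_le_power2] zero_le_power2, symmetric]
        by (rule sum_ennreal[symmetric]) (intro mult_nonneg_nonneg of_nat_0_le_iff zero_le_power2)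
      finally show "ennreal ((norm (\<Sum>j\<in>J. Q j (f j k x)))\<^sup>2) \<le> \<dots>" .
    qed
    also have "\<dots> = (\<Sum>j\<in>J. ennreal (real (card J) * (B j)\<^sup>2) * (\<integral>\<^sup>+x. ennreal ((norm (f j k x))\<^sup>2) \<partial>M))"
      using meas by (simp add: nn_integral_sum nn_integral_cmult)
    finally show ?thesis .
  qed
  have "(\<lambda>k. \<Sum>j\<in>J. ennreal (real (card J) * (B j)\<^sup>2) * (\<integral>\<^sup>+x. ennreal ((norm (f j k x))\<^sup>2) \<partial>M))
      \<longlonglongrightarrow> (\<Sum>j\<in>J. ennreal (real (card J) * (B j)\<^sup>2) * 0)"
    by (intro tendsto_sum ennreal_tendsto_cmult lim) (rule ennreal_less_top)
  then have "(\<lambda>k. \<Sum>j\<in>J. ennreal (real (card J) * (B j)\<^sup>2) * (\<integral>\<^sup>+x. ennreal ((norm (f j k x))\<^sup>2) \<partial>M))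
      \<longlonglongrightarrow> 0"
    by (simp only: mult_zero_right sum.neutral_const)
  from tendsto_sandwich[OF _ _ tendsto_const this] ub show ?thesis
    by (metis (no_types, lifting) always_eventually zero_le)
qed

section \<open>Simple processes and integrals up to different times\<close>

lemma simple_integrand_partition:
  assumes "simple_integrand M F t N p \<xi>" "i \<le> N"
  shows "0 \<le> p i" "p i \<le> t"
proof -
  have step: "p i \<le> p (Suc i)" if "i < N" for i using assms(1) that by (auto simp: simple_integrand_def)
  have "p 0 \<le> p i" using assms(2)
  proof (induction i)
    case (Suc i) then show ?case using step[of i] by simp
  qed simp
  then show "0 \<le> p i" using assms(1) by (auto simp: simple_integrand_def)
  have "p i \<le> p N" using assms(2)
  proof (induction rule: inc_induct)
    case (step i) then show ?case using \<open>\<And>i. i < N \<Longrightarrow> p i \<le> p (Suc i)\<close>[of i] by simp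
  qed simp
  then show "p i \<le> t" using assms(1) by (auto simp: simple_integrand_def)
qed

text \<open>Hence an approximation on \<open>[0, \<tau>]\<close>, viewed on a longer interval,
  approximates the integrand cut off at \<open>\<tau>\<close>.\<close>

lemma simple_process_eq_0:
  assumes "simple_integrand M F t N p \<xi>" "s \<notin> {0..t}"
  shows "simple_process N p \<xi> s \<omega> = 0"
proof -
  have "s \<notin> {p i<..p (Suc i)}" if "i < N" for i
    using simple_integrand_partition[OF assms(1), of i] simple_integrand_partition[OF assms(1), of "Suc i"] that assms(2)
    by auto
  then show ?thesis by (simp add: simple_process_def)
qed

lemma simple_process_measurable:
  assumes "\<And>i. i < N \<Longrightarrow> \<xi> i \<in> borel_measurable M"
  shows "(\<lambda>z. simple_process N p \<xi> (fst z) (snd z)) \<in> borel_measurable (lebesgue_on S \<Otimes>\<^sub>M M)"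
proof -
  have "(\<lambda>z. indicat_real {p i<..p (Suc i)} (fst z)) \<in> borel_measurable (lebesgue_on S \<Otimes>\<^sub>M M)" for i
    by (rule indicator_fst_measurable) simp
  moreover have "(\<lambda>z. \<xi> i (snd z)) \<in> borel_measurable (lebesgue_on S \<Otimes>\<^sub>M M)" if "i < N" for i
    by (rule measurable_compose[OF measurable_snd assms[OF that]])
  ultimately show ?thesis unfolding simple_process_def
    by (intro borel_measurable_sum borel_measurable_scaleR) auto
qed

text \<open>Turns convergence on each \<open>[0, \<tau> j]\<close>, which is what the Ito integral
  provides, into convergence of cut-off integrands on one common space.\<close>

lemma (in sigma_finite_measure) nn_integral_lebesgue_on_pair_restrict:
  fixes r t :: real
  assumes "f \<in> borel_measurable (lebesgue_on {0..t} \<Otimes>\<^sub>M M)" "f \<in> borel_measurable (lebesgue_on {0..r} \<Otimes>\<^sub>M M)"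
    and "r \<le> t"
  shows "(\<integral>\<^sup>+z. indicator {0..r} (fst z) * f z \<partial>(lebesgue_on {0..t} \<Otimes>\<^sub>M M)) = (\<integral>\<^sup>+z. f z \<partial>(lebesgue_on {0..r} \<Otimes>\<^sub>M M))"
proof -
  have "(\<lambda>z. indicator {0..r} (fst z)) \<in> borel_measurable (lebesgue_on {0..t} \<Otimes>\<^sub>M M)"
    by (rule indicator_fst_measurable) simp
  then have m: "(\<lambda>z. indicator {0..r} (fst z) * f z) \<in> borel_measurable (lebesgue_on {0..t} \<Otimes>\<^sub>M M)"
    using assms(1) by (rule borel_measurable_times_ennreal)
  have "(\<integral>\<^sup>+z. indicator {0..r} (fst z) * f z \<partial>(lebesgue_on {0..t} \<Otimes>\<^sub>M M))
      = (\<integral>\<^sup>+s. (\<integral>\<^sup>+\<omega>. indicator {0..r} s * f (s, \<omega>) \<partial>M) \<partial>lebesgue_on {0..t})"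
    using nn_integral_fst[OF m] by simp
  also have "\<dots> = (\<integral>\<^sup>+s. (\<integral>\<^sup>+\<omega>. indicator {0..r} s * f (s, \<omega>) \<partial>M) * indicator {0..t} s \<partial>lebesgue)"
    by (rule nn_integral_restrict_space) simp
  also have "\<dots> = (\<integral>\<^sup>+s. (\<integral>\<^sup>+\<omega>. f (s, \<omega>) \<partial>M) * indicator {0..r} s \<partial>lebesgue)"
    using \<open>r \<le> t\<close> by (intro nn_integral_cong) (auto simp: indicator_def)
  also have "\<dots> = (\<integral>\<^sup>+s. (\<integral>\<^sup>+\<omega>. f (s, \<omega>) \<partial>M) \<partial>lebesgue_on {0..r})"
    by (rule nn_integral_restrict_space[symmetric]) simp
  also have "\<dots> = (\<integral>\<^sup>+z. f z \<partial>(lebesgue_on {0..r} \<Otimes>\<^sub>M M))"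
    using nn_integral_fst[OF assms(2)] by simp
  finally show ?thesis .
qed

context wiener_process
begin

text \<open>For fixed \<open>k\<close>, the \<open>k\<close>-th approximants of all the integrals
  together form one finite family of weighted increments, to which the elementary isometry applies
  although their partitions are unrelated; then let \<open>k\<close> tend to infinity. With signs
  placed in \<open>Q\<close>, differences of integrals are covered too.\<close>

lemma nn_integral_linear_sum_ito_le:
  fixes g :: "real \<Rightarrow> 'a \<Rightarrow> 'b::euclidean_space" and Q :: "'j \<Rightarrow> 'b \<Rightarrow> 'd::euclidean_space"
  assumes "finite J" and lin: "\<And>j. j \<in> J \<Longrightarrow> linear (Q j)"
    and ito: "\<And>j. j \<in> J \<Longrightarrow> has_ito_integral M F W g (\<tau> j) (I j)"
    and \<tau>: "\<And>j. j \<in> J \<Longrightarrow> \<tau> j \<le> t"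
    and g: "(\<lambda>z. g (fst z) (snd z)) \<in> borel_measurable (lebesgue_on {0..t} \<Otimes>\<^sub>M M)"
  shows "(\<integral>\<^sup>+\<omega>. ennreal ((norm (\<Sum>j\<in>J. Q j (I j \<omega>)))\<^sup>2) \<partial>M) \<le>
    (\<integral>\<^sup>+z. ennreal ((norm (\<Sum>j\<in>J. Q j (indicat_real {0..\<tau> j} (fst z) *\<^sub>R g (fst z) (snd z))))\<^sup>2)
      \<partial>(lebesgue_on {0..t} \<Otimes>\<^sub>M M))"
proof -
  let ?P = "lebesgue_on {0..t} \<Otimes>\<^sub>M M"
  have "\<forall>j\<in>J. \<exists>N p \<xi>. (\<forall>k. simple_integrand M F (\<tau> j) (N k) (p k) (\<xi> k)) \<and>
        (\<lambda>k. \<integral>\<^sup>+z. ennreal ((norm (g (fst z) (snd z)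
                 - simple_process (N k) (p k) (\<xi> k) (fst z) (snd z)))\<^sup>2)
               \<partial>(lebesgue_on {0..\<tau> j} \<Otimes>\<^sub>M M)) \<longlonglongrightarrow> 0 \<and>
        (\<lambda>k. \<integral>\<^sup>+\<omega>. ennreal ((norm (I j \<omega> - simple_integral W (N k) (p k) (\<xi> k) \<omega>))\<^sup>2) \<partial>M) \<longlonglongrightarrow> 0"
    using ito unfolding has_ito_integral_def by blast
  then obtain N p \<xi> where "\<forall>j\<in>J. (\<forall>k. simple_integrand M F (\<tau> j) (N j k) (p j k) (\<xi> j k)) \<and>
        (\<lambda>k. \<integral>\<^sup>+z. ennreal ((norm (g (fst z) (snd z)
                 - simple_process (N j k) (p j k) (\<xi> j k) (fst z) (snd z)))\<^sup>2)
               \<partial>(lebesgue_on {0..\<tau> j} \<Otimes>\<^sub>M M)) \<longlonglongrightarrow> 0 \<and>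
        (\<lambda>k. \<integral>\<^sup>+\<omega>. ennreal ((norm (I j \<omega> - simple_integral W (N j k) (p j k) (\<xi> j k) \<omega>))\<^sup>2) \<partial>M) \<longlonglongrightarrow> 0"
    by (auto simp: bchoice_iff)
  then have simp: "\<And>j k. j \<in> J \<Longrightarrow> simple_integrand M F (\<tau> j) (N j k) (p j k) (\<xi> j k)"
    and limV: "\<And>j. j \<in> J \<Longrightarrow> (\<lambda>k. \<integral>\<^sup>+z. ennreal ((norm (g (fst z) (snd z)
                 - simple_process (N j k) (p j k) (\<xi> j k) (fst z) (snd z)))\<^sup>2)
               \<partial>(lebesgue_on {0..\<tau> j} \<Otimes>\<^sub>M M)) \<longlonglongrightarrow> 0"
    and limX: "\<And>j. j \<in> J \<Longrightarrow>
        (\<lambda>k. \<integral>\<^sup>+\<omega>. ennreal ((norm (I j \<omega> - simple_integral W (N j k) (p j k) (\<xi> j k) \<omega>))\<^sup>2) \<partial>M) \<longlonglongrightarrow> 0"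
    by blast+
  have part: "0 \<le> p j k i" "p j k i \<le> p j k (Suc i)" "0 \<le> p j k (Suc i)" "p j k (Suc i) \<le> t"
    if "j \<in> J" "i < N j k" for j k i
    using simple_integrand_partition[OF simp[OF that(1), of k], of i]
      simple_integrand_partition[OF simp[OF that(1), of k], of "Suc i"] that \<tau>[OF that(1)] simp[OF that(1), of k]
    by (auto simp: simple_integrand_def)
  have \<xi>F: "\<xi> j k i \<in> borel_measurable (F (p j k i))" if "j \<in> J" "i < N j k" for j k i
    using simp[OF that(1), of k] that by (simp add: simple_integrand_def)
  have \<xi>M: "\<xi> j k i \<in> borel_measurable M" if "j \<in> J" "i < N j k" for j k i
    using measurable_F_M[OF part(1) \<xi>F] that by blast
  have Qm: "(\<lambda>x. Q j (f x)) \<in> borel_measurable K" if "j \<in> J" "f \<in> borel_measurable K" for j f and K :: "'e measure"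
    using measurable_compose[OF that(2), of "Q j" borel] lin[OF that(1)]
    by (simp add: borel_measurable_continuous_onI linear_continuous_on linear_linear)
  have Im: "I j \<in> borel_measurable M" if "j \<in> J" for j
    using ito[OF that] by (simp add: has_ito_integral_def)
  have SIm: "simple_integral W (N j k) (p j k) (\<xi> j k) \<in> borel_measurable M" if "j \<in> J" for j k
    unfolding simple_integral_def using part \<xi>M that
    by (intro borel_measurable_sum borel_measurable_scaleR borel_measurable_diff W_measurable_M) auto
  have SPm: "(\<lambda>z. simple_process (N j k) (p j k) (\<xi> j k) (fst z) (snd z)) \<in> borel_measurable (lebesgue_on S \<Otimes>\<^sub>M M)"
    if "j \<in> J" for j k S
    using \<xi>M that by (intro simple_process_measurable) auto
  have gi: "(\<lambda>z. indicat_real {0..\<tau> j} (fst z) *\<^sub>R g (fst z) (snd z)) \<in> borel_measurable ?P" for j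
  proof (rule borel_measurable_scaleR[OF _ g])
    show "(\<lambda>z. indicat_real {0..\<tau> j} (fst z)) \<in> borel_measurable ?P"
      by (rule indicator_fst_measurable) simp
  qed
  define X where "X \<omega> = (\<Sum>j\<in>J. Q j (I j \<omega>))" for \<omega>
  define Xs where "Xs k \<omega> = (\<Sum>j\<in>J. Q j (simple_integral W (N j k) (p j k) (\<xi> j k) \<omega>))" for k \<omega>
  define V where "V z = (\<Sum>j\<in>J. Q j (indicat_real {0..\<tau> j} (fst z) *\<^sub>R g (fst z) (snd z)))" for z
  define Vs where "Vs k z = (\<Sum>j\<in>J. Q j (simple_process (N j k) (p j k) (\<xi> j k) (fst z) (snd z)))" for k z
  have "(\<integral>\<^sup>+x. ennreal ((norm (X x))\<^sup>2) \<partial>M) \<le> (\<integral>\<^sup>+x. ennreal ((norm (V x))\<^sup>2) \<partial>?P)"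
  proof (rule nn_integral_power2_norm_L2_limit_le)
    show "X \<in> borel_measurable M" "V \<in> borel_measurable ?P"
      "Xs k \<in> borel_measurable M" "Vs k \<in> borel_measurable ?P" for k
      unfolding X_def V_def Xs_def Vs_def using Im SIm SPm gi
      by (auto intro!: borel_measurable_sum Qm)
    have "(\<lambda>k. \<integral>\<^sup>+\<omega>. ennreal ((norm (\<Sum>j\<in>J. Q j (I j \<omega> - simple_integral W (N j k) (p j k) (\<xi> j k) \<omega>)))\<^sup>2) \<partial>M) \<longlonglongrightarrow> 0"
      using limX Im SIm by (intro tendsto_nn_integral_power2_norm_linear_sum \<open>finite J\<close> lin) auto
    moreover have "X \<omega> - Xs k \<omega> = (\<Sum>j\<in>J. Q j (I j \<omega> - simple_integral W (N j k) (p j k) (\<xi> j k) \<omega>))" for k \<omega>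
      unfolding X_def Xs_def sum_subtractf[symmetric] by (intro sum.cong refl) (simp add: linear_diff[OF lin])
    ultimately show "(\<lambda>k. \<integral>\<^sup>+x. ennreal ((norm (X x - Xs k x))\<^sup>2) \<partial>M) \<longlonglongrightarrow> 0" by simp
    have "(\<lambda>k. \<integral>\<^sup>+z. ennreal ((norm (indicat_real {0..\<tau> j} (fst z) *\<^sub>R g (fst z) (snd z)
        - simple_process (N j k) (p j k) (\<xi> j k) (fst z) (snd z)))\<^sup>2) \<partial>?P) \<longlonglongrightarrow> 0" if j: "j \<in> J" for j
    proof -
      have "ennreal ((norm (indicat_real {0..\<tau> j} (fst z) *\<^sub>R g (fst z) (snd z)
          - simple_process (N j k) (p j k) (\<xi> j k) (fst z) (snd z)))\<^sup>2) =
        indicator {0..\<tau> j} (fst z) * ennreal ((norm (g (fst z) (snd z)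
          - simple_process (N j k) (p j k) (\<xi> j k) (fst z) (snd z)))\<^sup>2)" for k z
        by (cases "fst z \<in> {0..\<tau> j}") (simp_all add: simple_process_eq_0[OF simp[OF j]])
      moreover have "(\<integral>\<^sup>+z. indicator {0..\<tau> j} (fst z) * ennreal ((norm (g (fst z) (snd z)
          - simple_process (N j k) (p j k) (\<xi> j k) (fst z) (snd z)))\<^sup>2) \<partial>?P) =
        (\<integral>\<^sup>+z. ennreal ((norm (g (fst z) (snd z)
          - simple_process (N j k) (p j k) (\<xi> j k) (fst z) (snd z)))\<^sup>2) \<partial>(lebesgue_on {0..\<tau> j} \<Otimes>\<^sub>M M))" for k
        using g ito[OF j] SPm[OF j] \<tau>[OF j]
        by (intro nn_integral_lebesgue_on_pair_restrict measurable_compose[OF _ measurable_ennreal]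
            borel_measurable_power borel_measurable_norm borel_measurable_diff)
          (auto simp: has_ito_integral_def)
      ultimately show ?thesis using limV[OF j] by simp
    qed
    then have "(\<lambda>k. \<integral>\<^sup>+z. ennreal ((norm (\<Sum>j\<in>J. Q j (indicat_real {0..\<tau> j} (fst z) *\<^sub>R g (fst z) (snd z)
        - simple_process (N j k) (p j k) (\<xi> j k) (fst z) (snd z))))\<^sup>2) \<partial>?P) \<longlonglongrightarrow> 0"
      using gi SPm by (intro tendsto_nn_integral_power2_norm_linear_sum \<open>finite J\<close> lin) auto
    moreover have "V z - Vs k z = (\<Sum>j\<in>J. Q j (indicat_real {0..\<tau> j} (fst z) *\<^sub>R g (fst z) (snd z)
        - simple_process (N j k) (p j k) (\<xi> j k) (fst z) (snd z)))" for k z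
      unfolding V_def Vs_def sum_subtractf[symmetric] by (intro sum.cong refl) (simp add: linear_diff[OF lin])
    ultimately show "(\<lambda>k. \<integral>\<^sup>+x. ennreal ((norm (V x - Vs k x))\<^sup>2) \<partial>?P) \<longlonglongrightarrow> 0" by simp
    fix k
    \<comment> \<open>The family consists of all subintervals of all the partitions. Each
      \<open>Q j\<close> is linear and deterministic, so it moves inside the sums and its image of a
      bounded weight is bounded and still known at the left endpoint.\<close>
    define K where "K = Sigma J (\<lambda>j. {..<N j k})"
    define a where "a = (\<lambda>(j, i). p j k i)"
    define b where "b = (\<lambda>(j, i). p j k (Suc i))"
    define \<zeta> where "\<zeta> = (\<lambda>(j, i) \<omega>. Q j (\<xi> j k i \<omega>))"
    have "\<forall>j i. \<exists>C. j \<in> J \<and> i < N j k \<longrightarrow> (\<forall>\<omega>\<in>space M. norm (Q j (\<xi> j k i \<omega>)) \<le> C)"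
    proof (intro allI)
      fix j i
      show "\<exists>C. j \<in> J \<and> i < N j k \<longrightarrow> (\<forall>\<omega>\<in>space M. norm (Q j (\<xi> j k i \<omega>)) \<le> C)"
      proof (cases "j \<in> J \<and> i < N j k")
        case True
        then obtain C where C: "\<forall>\<omega>\<in>space M. norm (\<xi> j k i \<omega>) \<le> C"
          using simp[of j k] by (auto simp: simple_integrand_def)
        obtain B where B: "0 < B" "\<And>x. norm (Q j x) \<le> B * norm x"
          using linear_bounded_pos[OF lin] True by blast
        have "norm (Q j (\<xi> j k i \<omega>)) \<le> B * C" if "\<omega> \<in> space M" for \<omega>
          using B(2)[of "\<xi> j k i \<omega>"] mult_left_mono[OF C[rule_format, OF that], of B] B(1) by linarith
        then show ?thesis by blast
      qed blast
    qed
    then obtain C where C: "\<And>j i \<omega>. j \<in> J \<Longrightarrow> i < N j k \<Longrightarrow> \<omega> \<in> space M \<Longrightarrow> norm (Q j (\<xi> j k i \<omega>)) \<le> C j i"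
      by metis
    have QF: "(\<lambda>\<omega>. Q j (\<xi> j k i \<omega>)) \<in> borel_measurable (F (p j k i))" if "j \<in> J" "i < N j k" for j i
      by (rule Qm[OF that(1) \<xi>F[OF that]])
    have "(\<integral>\<^sup>+\<omega>. ennreal ((norm (\<Sum>i\<in>K. (W (b i) \<omega> - W (a i) \<omega>) *\<^sub>R \<zeta> i \<omega>))\<^sup>2) \<partial>M) =
      (\<integral>\<^sup>+z. ennreal ((norm (\<Sum>i\<in>K. indicat_real {a i<..b i} (fst z) *\<^sub>R \<zeta> i (snd z)))\<^sup>2) \<partial>?P)"
    proof (rule elementary_ito_isometry[where C = "case_prod C"])
      show "finite K" unfolding K_def using \<open>finite J\<close> by auto
    qed (use part C QF in \<open>auto simp: K_def a_def b_def \<zeta>_def\<close>)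
    moreover have "(\<Sum>i\<in>K. (W (b i) \<omega> - W (a i) \<omega>) *\<^sub>R \<zeta> i \<omega>) = Xs k \<omega>" for \<omega>
    proof -
      have "(\<Sum>i\<in>K. (W (b i) \<omega> - W (a i) \<omega>) *\<^sub>R \<zeta> i \<omega>) =
          (\<Sum>j\<in>J. \<Sum>i<N j k. (W (p j k (Suc i)) \<omega> - W (p j k i) \<omega>) *\<^sub>R Q j (\<xi> j k i \<omega>))"
        unfolding K_def using \<open>finite J\<close> by (subst sum.Sigma) (simp_all add: a_def b_def \<zeta>_def case_prod_beta)
      also have "\<dots> = Xs k \<omega>"
        unfolding Xs_def simple_integral_def by (intro sum.cong refl) (simp add: linear_sum[OF lin] linear_scale[OF lin])
      finally show ?thesis .
    qed
    moreover have "(\<Sum>i\<in>K. indicat_real {a i<..b i} (fst z) *\<^sub>R \<zeta> i (snd z)) = Vs k z" for z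
    proof -
      have "(\<Sum>i\<in>K. indicat_real {a i<..b i} (fst z) *\<^sub>R \<zeta> i (snd z)) =
          (\<Sum>j\<in>J. \<Sum>i<N j k. indicat_real {p j k i<..p j k (Suc i)} (fst z) *\<^sub>R Q j (\<xi> j k i (snd z)))"
        unfolding K_def using \<open>finite J\<close> by (subst sum.Sigma) (simp_all add: a_def b_def \<zeta>_def case_prod_beta)
      also have "\<dots> = Vs k z"
        unfolding Vs_def simple_process_def by (intro sum.cong refl) (simp add: linear_sum[OF lin] linear_scale[OF lin])
      finally show ?thesis .
    qed
    ultimately show "(\<integral>\<^sup>+x. ennreal ((norm (Xs k x))\<^sup>2) \<partial>M) = (\<integral>\<^sup>+x. ennreal ((norm (Vs k x))\<^sup>2) \<partial>?P)"
      by simp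
  qed
  then show ?thesis unfolding X_def V_def .
qed

end

section \<open>Euler sums\<close>

text \<open>The explicit Euler scheme for \<open>dy = f y dt + dI\<close> with start 0, solved in
  closed form so that it is visibly a linear combination of increments of \<open>I\<close>. Only
  \<open>j < n\<close> occur, so the natural subtraction in the exponent never truncates.\<close>

definition euler_sum :: "('b::real_normed_vector \<Rightarrow> 'b) \<Rightarrow> (real \<Rightarrow> 'b) \<Rightarrow> real \<Rightarrow> nat \<Rightarrow> 'b" where
  "euler_sum f I \<delta> n = (\<Sum>j<n. ((\<lambda>v. v + \<delta> *\<^sub>R f v) ^^ (n - 1 - j)) (I (real (Suc j) * \<delta>) - I (real j * \<delta>)))"

lemma linear_euler_step: "linear f \<Longrightarrow> linear (\<lambda>v. v + \<delta> *\<^sub>R f v)"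
  by (intro linear_compose_add linear_id linear_compose_scale_right) (simp_all add: linear_ident)

lemma linear_funpow:
  fixes f :: "'b::real_vector \<Rightarrow> 'b"
  shows "linear f \<Longrightarrow> linear (f ^^ n)"
  by (induction n) (auto intro: linear_compose simp: id_def linear_ident)

lemma euler_sum_Suc:
  assumes "linear f"
  shows "euler_sum f I \<delta> (Suc n) = euler_sum f I \<delta> n + \<delta> *\<^sub>R f (euler_sum f I \<delta> n)
    + (I (real (Suc n) * \<delta>) - I (real n * \<delta>))"
proof -
  define P where "P v = v + \<delta> *\<^sub>R f v" for v
  have P: "linear P" unfolding P_def using assms by (rule linear_euler_step)
  \<comment> \<open>Every old term gains one factor \<open>P\<close>; the new term
    \<open>j = n\<close> has exponent 0.\<close>
  have "(P ^^ (Suc n - 1 - j)) x = P ((P ^^ (n - 1 - j)) x)" if "j < n" for j x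
  proof -
    have "Suc n - 1 - j = Suc (n - 1 - j)" using that by simp
    then show ?thesis by simp
  qed
  then have "(\<Sum>j<n. (P ^^ (Suc n - 1 - j)) (I (real (Suc j) * \<delta>) - I (real j * \<delta>)))
      = P (\<Sum>j<n. (P ^^ (n - 1 - j)) (I (real (Suc j) * \<delta>) - I (real j * \<delta>)))"
    unfolding linear_sum[OF P] by (intro sum.cong refl) auto
  moreover have "(\<lambda>v. v + \<delta> *\<^sub>R f v) = P" by (simp add: P_def fun_eq_iff)
  ultimately have "euler_sum f I \<delta> (Suc n) = P (euler_sum f I \<delta> n) + (I (real (Suc n) * \<delta>) - I (real n * \<delta>))"
    unfolding euler_sum_def by simp
  then show ?thesis by (simp add: P_def)
qed

text \<open>The increments of \<open>I\<close> cancel in the difference. Per step there remains the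
  error of freezing \<open>f (y s)\<close> at the left grid point, at most
  \<open>\<delta> * L * \<eta>\<close>, and a discrete Gronwall argument accumulates these
  errors.\<close>

lemma euler_sum_error:
  fixes y :: "real \<Rightarrow> 'b::euclidean_space"
  assumes "linear f" and L: "0 \<le> L" "\<And>x. norm (f x) \<le> L * norm x"
    and cont: "continuous_on {0..t} y" and "0 \<le> \<delta>" and y0: "y 0 = 0" and "0 \<le> \<eta>"
    and osc: "\<And>r s. r \<in> {0..t} \<Longrightarrow> s \<in> {0..t} \<Longrightarrow> \<bar>r - s\<bar> \<le> \<delta> \<Longrightarrow> norm (y r - y s) \<le> \<eta>"
    and eq: "\<And>j. j \<le> N \<Longrightarrow> y (real j * \<delta>) = integral {0..real j * \<delta>} (\<lambda>s. f (y s)) + I (real j * \<delta>)"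
    and n: "n \<le> N" and N: "real N * \<delta> \<le> t"
  shows "norm (y (real n * \<delta>) - euler_sum f I \<delta> n) \<le> real n * (\<delta> * L * \<eta>) * (1 + \<delta> * L) ^ n"
  using n
proof (induction n)
  case 0 then show ?case by (simp add: euler_sum_def y0)
next
  case (Suc n)
  interpret f: linear f by fact
  let ?a = "real n * \<delta>" and ?b = "real (Suc n) * \<delta>"
  have a0: "0 \<le> ?a" and ab: "?a \<le> ?b" and "?b - ?a = \<delta>" using \<open>0 \<le> \<delta>\<close> by (auto simp: algebra_simps)
  have bt: "?b \<le> t"
  proof -
    have "?b \<le> real N * \<delta>" using Suc.prems \<open>0 \<le> \<delta>\<close> by (intro mult_right_mono) simp_all
    with N show ?thesis by simp
  qed
  have contf: "continuous_on {0..t} (\<lambda>s. f (y s))"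
    using continuous_on_compose2[OF linear_continuous_on cont, of f UNIV] \<open>linear f\<close>
    by (simp add: linear_conv_bounded_linear)
  have int: "(\<lambda>s. f (y s)) integrable_on {c..d}" if "0 \<le> c" "d \<le> t" for c d
    by (rule integrable_continuous_real) (use that in \<open>auto intro: continuous_on_subset[OF contf]\<close>)
  have "integral {0..?a} (\<lambda>s. f (y s)) + integral {?a..?b} (\<lambda>s. f (y s)) = integral {0..?b} (\<lambda>s. f (y s))"
    by (rule Henstock_Kurzweil_Integration.integral_combine[OF a0 ab int[OF order.refl bt]])
  then have step: "y ?b = y ?a + integral {?a..?b} (\<lambda>s. f (y s)) + (I ?b - I ?a)"
    using eq[of n] eq[of "Suc n"] Suc.prems by (simp add: algebra_simps)
  define R where "R = integral {?a..?b} (\<lambda>s. f (y s) - f (y ?a))"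
  have "R = integral {?a..?b} (\<lambda>s. f (y s)) - integral {?a..?b} (\<lambda>s. f (y ?a))"
    unfolding R_def by (rule Henstock_Kurzweil_Integration.integral_diff) (use int[OF a0 bt] in auto)
  then have R: "integral {?a..?b} (\<lambda>s. f (y s)) = R + \<delta> *\<^sub>R f (y ?a)"
    using \<open>?b - ?a = \<delta>\<close> ab by simp
  have "norm R \<le> (L * \<eta>) * (?b - ?a)"
    unfolding R_def
  proof (rule integral_bound[OF ab])
    show "continuous_on {?a..?b} (\<lambda>s. f (y s) - f (y ?a))"
      by (intro continuous_intros continuous_on_subset[OF contf]) (use a0 bt in auto)
    fix s assume s: "s \<in> {?a..?b}"
    have "norm (f (y s) - f (y ?a)) \<le> L * norm (y s - y ?a)" using L(2)[of "y s - y ?a"] by (simp add: f.diff)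
    also have "\<dots> \<le> L * \<eta>"
    proof (intro mult_left_mono osc L(1))
      have "?a \<le> s" "s \<le> ?b" using s by auto
      with a0 ab bt \<open>?b - ?a = \<delta>\<close> show "s \<in> {0..t}" "?a \<in> {0..t}" "\<bar>s - ?a\<bar> \<le> \<delta>"
        unfolding atLeastAtMost_iff by linarith+
    qed
    finally show "norm (f (y s) - f (y ?a)) \<le> L * \<eta>" .
  qed
  then have nR: "norm R \<le> \<delta> * L * \<eta>" using \<open>?b - ?a = \<delta>\<close> by (simp add: mult_ac)
  define e where "e = y ?a - euler_sum f I \<delta> n"
  have "y ?b - euler_sum f I \<delta> (Suc n) = e + \<delta> *\<^sub>R f e + R"
    unfolding step R euler_sum_Suc[OF \<open>linear f\<close>] e_def f.diff by (simp add: scaleR_diff_right)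
  then have "norm (y ?b - euler_sum f I \<delta> (Suc n)) \<le> norm e + \<delta> * norm (f e) + norm R"
    using norm_triangle_ineq[of "e + \<delta> *\<^sub>R f e" R] norm_triangle_ineq[of e "\<delta> *\<^sub>R f e"] \<open>0 \<le> \<delta>\<close> by simp
  also have "\<dots> \<le> norm e + \<delta> * (L * norm e) + \<delta> * L * \<eta>"
    using L(2)[of e] nR \<open>0 \<le> \<delta>\<close> by (intro add_mono mult_left_mono) auto
  \<comment> \<open>The factor 1 is written out so that the next line can enlarge it to a power of
    \<open>1 + \<delta> * L\<close>, which makes the new error fit the closed form.\<close>
  also have "\<dots> = (1 + \<delta> * L) * norm e + \<delta> * L * \<eta> * 1" by (simp add: algebra_simps)
  also have "\<dots> \<le> (1 + \<delta> * L) * (real n * (\<delta> * L * \<eta>) * (1 + \<delta> * L) ^ n) + \<delta> * L * \<eta> * (1 + \<delta> * L) ^ Suc n"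
    using Suc.IH Suc.prems \<open>0 \<le> \<delta>\<close> L(1) \<open>0 \<le> \<eta>\<close>
    by (intro add_mono mult_left_mono one_le_power) (auto simp: e_def)
  also have "\<dots> = real (Suc n) * (\<delta> * L * \<eta>) * (1 + \<delta> * L) ^ Suc n" by (simp add: algebra_simps)
  finally show ?case .
qed

lemma euler_sum_tendsto:
  fixes y :: "real \<Rightarrow> 'b::euclidean_space"
  assumes "linear f" and "0 < t" and cont: "continuous_on {0..t} y" and y0: "y 0 = 0"
    and eq: "\<And>N j. 0 < N \<Longrightarrow> j \<le> N \<Longrightarrow> y (real j * (t / real N)) =
      integral {0..real j * (t / real N)} (\<lambda>s. f (y s)) + I (real j * (t / real N))"
  shows "(\<lambda>N. euler_sum f I (t / real N) N) \<longlonglongrightarrow> y t"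
proof (rule LIMSEQ_I)
  fix \<epsilon> :: real assume "0 < \<epsilon>"
  obtain L where L: "0 < L" "\<And>x. norm (f x) \<le> L * norm x"
    using linear_bounded_pos[OF \<open>linear f\<close>] by blast
  \<comment> \<open>The accumulated error will be at most
    \<open>t * L * exp (t * L) * \<eta>\<close>; this choice makes it
    \<open>\<epsilon> / 2\<close>.\<close>
  define \<eta> where "\<eta> = \<epsilon> / (2 * (t * L * exp (t * L)))"
  have "0 < t * L * exp (t * L)" using \<open>0 < t\<close> L by simp
  then have \<eta>: "0 < \<eta>" "t * L * exp (t * L) * \<eta> < \<epsilon>" using \<open>0 < \<epsilon>\<close> by (simp_all add: \<eta>_def field_simps)
  have "uniformly_continuous_on {0..t} y"
    using cont by (rule compact_uniformly_continuous) simp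
  then obtain d where d: "0 < d" "\<And>r s. r \<in> {0..t} \<Longrightarrow> s \<in> {0..t} \<Longrightarrow> dist s r < d \<Longrightarrow> dist (y s) (y r) < \<eta>"
    using \<eta>(1) unfolding uniformly_continuous_on_def by metis
  obtain N0 where N0: "t / d < real N0" using reals_Archimedean2 by blast
  show "\<exists>no. \<forall>N\<ge>no. norm (euler_sum f I (t / real N) N - y t) < \<epsilon>"
  proof (intro exI allI impI)
    fix N assume "Suc N0 \<le> N"
    then have N: "0 < N" "t / d < real N" using N0 by auto
    define \<delta> where "\<delta> = t / real N"
    have \<delta>: "0 \<le> \<delta>" "\<delta> < d" "real N * \<delta> = t" using N \<open>0 < t\<close> \<open>0 < d\<close> by (auto simp: \<delta>_def field_simps)
    have "norm (y (real N * \<delta>) - euler_sum f I \<delta> N) \<le> real N * (\<delta> * L * \<eta>) * (1 + \<delta> * L) ^ N"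
    proof (rule euler_sum_error[where t = t and N = N])
      show "norm (y r - y s) \<le> \<eta>" if "r \<in> {0..t}" "s \<in> {0..t}" "\<bar>r - s\<bar> \<le> \<delta>" for r s
        using d(2)[of s r] that \<delta> by (simp add: dist_norm)
    qed (use assms L \<delta> \<eta> N eq in \<open>auto simp: \<delta>_def\<close>)
    also have "\<dots> = t * L * \<eta> * (1 + \<delta> * L) ^ N" using \<delta>(3) by (simp add: algebra_simps)
    also have "\<dots> \<le> t * L * \<eta> * exp (t * L)"
    proof (rule mult_left_mono)
      have "(1 + \<delta> * L) ^ N \<le> exp (\<delta> * L) ^ N"
        using \<delta> L by (intro power_mono exp_ge_add_one_self) simp
      also have "\<dots> = exp (t * L)" by (simp add: exp_of_nat_mult[symmetric] \<delta>(3)[symmetric] mult_ac)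
      finally show "(1 + \<delta> * L) ^ N \<le> exp (t * L)" .
    qed (use \<open>0 < t\<close> L \<eta> in simp)
    finally show "norm (euler_sum f I (t / real N) N - y t) < \<epsilon>"
      using \<eta>(2) \<delta>(3) by (simp add: \<delta>_def norm_minus_commute mult_ac)
  qed
qed

text \<open>Expanding the square keeps the first-order gain \<open>2 * c * \<delta>\<close> from
  dissipativity; the operator bound \<open>L\<close> is spent only on the term of order
  \<open>\<delta>\<^sup>2\<close>.\<close>

lemma dissipative_euler_step:
  fixes f :: "'b::euclidean_space \<Rightarrow> 'b"
  assumes "\<And>x. x \<bullet> f x \<le> - c * (norm x)\<^sup>2" and L: "0 \<le> L" "\<And>x. norm (f x) \<le> L * norm x" and "0 \<le> \<delta>"
  defines "\<rho> \<equiv> 1 - 2 * c * \<delta> + L\<^sup>2 * \<delta>\<^sup>2"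
  shows "0 \<le> \<rho>" "(norm (((\<lambda>v. v + \<delta> *\<^sub>R f v) ^^ m) x))\<^sup>2 \<le> \<rho> ^ m * (norm x)\<^sup>2"
proof -
  have step: "(norm (v + \<delta> *\<^sub>R f v))\<^sup>2 \<le> \<rho> * (norm v)\<^sup>2" for v
  proof -
    have "(norm (v + \<delta> *\<^sub>R f v))\<^sup>2 = (norm v)\<^sup>2 + 2 * \<delta> * (v \<bullet> f v) + \<delta>\<^sup>2 * (norm (f v))\<^sup>2"
      unfolding power2_norm_eq_inner power2_eq_square[of \<delta>]
      by (simp add: inner_add_left inner_add_right inner_commute algebra_simps)
    also have "\<dots> \<le> (norm v)\<^sup>2 + 2 * \<delta> * (- c * (norm v)\<^sup>2) + \<delta>\<^sup>2 * (L * norm v)\<^sup>2"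
      using assms by (intro add_mono mult_left_mono power_mono) auto
    also have "\<dots> = \<rho> * (norm v)\<^sup>2" by (simp add: \<rho>_def power_mult_distrib algebra_simps)
    finally show ?thesis .
  qed
  \<comment> \<open>Nonnegativity of \<open>\<rho>\<close> is read off from the step estimate at a
    unit vector; the induction needs it to multiply inequalities by \<open>\<rho>\<close>.\<close>
  obtain u :: 'b where "norm u = 1" using vector_choose_size[of 1] by auto
  with step[of u] have "(norm (u + \<delta> *\<^sub>R f u))\<^sup>2 \<le> \<rho>" by simp
  then show \<rho>0: "0 \<le> \<rho>" by (meson order_trans zero_le_power2)
  show "(norm (((\<lambda>v. v + \<delta> *\<^sub>R f v) ^^ m) x))\<^sup>2 \<le> \<rho> ^ m * (norm x)\<^sup>2"
  proof (induction m)
    case (Suc m)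
    define w where "w = ((\<lambda>v. v + \<delta> *\<^sub>R f v) ^^ m) x"
    have "(norm (w + \<delta> *\<^sub>R f w))\<^sup>2 \<le> \<rho> * (norm w)\<^sup>2" by (rule step)
    also have "\<dots> \<le> \<rho> * (\<rho> ^ m * (norm x)\<^sup>2)" using Suc.IH \<rho>0 unfolding w_def by (intro mult_left_mono)
    finally show ?case by (simp add: w_def mult.assoc)
  qed simp
qed

section \<open>Second moments of Euler sums and of the solution\<close>

context wiener_process
begin

text \<open>After the isometry the integrand at time \<open>s\<close> involves only the grid
  interval that contains \<open>s\<close>, so the sum inside the norm collapses to one term without
  cross terms. On the interval of index \<open>j\<close> this term has squared norm at most
  \<open>\<rho> ^ (N - 1 - j) * c\<^sup>2\<close>, and each interval has length
  \<open>\<delta>\<close>.\<close>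

lemma nn_integral_euler_sum_le:
  fixes f :: "'b::euclidean_space \<Rightarrow> 'b" and \<sigma> :: "real \<Rightarrow> 'b"
  assumes "linear f" and diss: "\<And>x. x \<bullet> f x \<le> - k * (norm x)\<^sup>2"
    and L: "0 \<le> L" "\<And>x. norm (f x) \<le> L * norm x" and "0 < \<delta>"
    and \<sigma>: "\<sigma> \<in> borel_measurable (lebesgue_on {0..real N * \<delta>})"
    and \<sigma>c: "AE s in lebesgue_on {0..real N * \<delta>}. norm (\<sigma> s) \<le> c" and "0 \<le> c"
    and ito: "\<And>j. j \<le> N \<Longrightarrow> has_ito_integral M F W (\<lambda>s \<omega>. \<sigma> s) (real j * \<delta>) (I (real j * \<delta>))"
  shows "(\<integral>\<^sup>+\<omega>. ennreal ((norm (euler_sum f (\<lambda>\<tau>. I \<tau> \<omega>) \<delta> N))\<^sup>2) \<partial>M) \<le>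
    ennreal (c\<^sup>2 * \<delta> * (\<Sum>j<N. (1 - 2 * k * \<delta> + L\<^sup>2 * \<delta>\<^sup>2) ^ j))"
proof -
  define t where "t = real N * \<delta>"
  let ?L = "lebesgue_on {0..t}"
  define \<rho> where "\<rho> = 1 - 2 * k * \<delta> + L\<^sup>2 * \<delta>\<^sup>2"
  define P where "P m = (\<lambda>v. v + \<delta> *\<^sub>R f v) ^^ m" for m :: nat
  have linP: "linear (P m)" for m
    unfolding P_def by (intro linear_funpow linear_euler_step \<open>linear f\<close>)
  have \<rho>0: "0 \<le> \<rho>" and nP: "(norm (P m x))\<^sup>2 \<le> \<rho> ^ m * (norm x)\<^sup>2" for m x
    unfolding \<rho>_def P_def using dissipative_euler_step[OF diss L, of \<delta>] \<open>0 < \<delta>\<close> by auto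
  \<comment> \<open>The boolean selects an endpoint: \<open>True\<close> stands for the integral up
    to \<open>(j + 1) * \<delta>\<close>, \<open>False\<close> for minus the one up to
    \<open>j * \<delta>\<close>.\<close>
  define J where "J = {..<N} \<times> (UNIV :: bool set)"
  define Q where "Q = (\<lambda>(j, b) x. if b then P (N - 1 - j) x else - P (N - 1 - j) x)"
  define \<tau> where "\<tau> = (\<lambda>(j, b). if b then real (Suc j) * \<delta> else real j * \<delta>)"
  have sumJ: "(\<Sum>j\<in>J. Q j (h (\<tau> j))) = (\<Sum>j<N. P (N - 1 - j) (h (real (Suc j) * \<delta>) - h (real j * \<delta>)))"
    for h :: "real \<Rightarrow> 'b"
  proof -
    have "(\<Sum>j\<in>J. Q j (h (\<tau> j))) = (\<Sum>j<N. \<Sum>b\<in>UNIV. Q (j, b) (h (\<tau> (j, b))))"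
      unfolding J_def by (simp add: sum.cartesian_product case_prod_beta)
    then show ?thesis by (simp add: Q_def \<tau>_def UNIV_bool linear_diff[OF linP])
  qed
  have \<tau>t: "\<tau> j \<le> t" if "j \<in> J" for j
    using that \<open>0 < \<delta>\<close> by (auto simp: J_def \<tau>_def t_def intro!: mult_right_mono)
  have g: "(\<lambda>z. \<sigma> (fst z)) \<in> borel_measurable (?L \<Otimes>\<^sub>M M)"
    using \<sigma> unfolding t_def by (rule measurable_compose[OF measurable_fst])
  define u where "u j s = indicat_real {real j * \<delta><..real (Suc j) * \<delta>} s" for j s
  define v where "v s = (\<Sum>j<N. P (N - 1 - j) (u j s *\<^sub>R \<sigma> s))" for s
  have v: "(\<Sum>j\<in>J. Q j (indicat_real {0..\<tau> j} s *\<^sub>R \<sigma> s)) = v s" if "0 \<le> s" for s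
  proof -
    have "indicat_real {0..real (Suc j) * \<delta>} s *\<^sub>R \<sigma> s - indicat_real {0..real j * \<delta>} s *\<^sub>R \<sigma> s = u j s *\<^sub>R \<sigma> s" for j
    proof -
      have "real j * \<delta> \<le> real (Suc j) * \<delta>" using \<open>0 < \<delta>\<close> by (intro mult_right_mono) auto
      then have "indicat_real {0..real (Suc j) * \<delta>} s - indicat_real {0..real j * \<delta>} s = u j s"
        using that by (auto simp: u_def indicator_def)
      then show ?thesis by (simp add: scaleR_diff_left[symmetric])
    qed
    then show ?thesis
      unfolding v_def sumJ[of "\<lambda>r. indicat_real {0..r} s *\<^sub>R \<sigma> s"] by simp
  qed
  have vle: "(norm (v s))\<^sup>2 \<le> (\<Sum>j<N. \<rho> ^ (N - 1 - j) * c\<^sup>2 * u j s)" if "norm (\<sigma> s) \<le> c" for s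
  proof (cases "\<exists>i<N. s \<in> {real i * \<delta><..real (Suc i) * \<delta>}")
    case False
    then have "u j s = 0" if "j < N" for j using that by (auto simp: u_def)
    then have "v s = 0" unfolding v_def by (simp add: linear_0[OF linP])
    then show ?thesis using \<rho>0 by (auto intro!: sum_nonneg simp: u_def)
  next
    case True
    then obtain i where i: "i < N" "s \<in> {real i * \<delta><..real (Suc i) * \<delta>}" by blast
    have uj: "u j s = (if j = i then 1 else 0)" for j
    proof (cases "s \<in> {real j * \<delta><..real (Suc j) * \<delta>}")
      case True
      then have "real j * \<delta> < real (Suc i) * \<delta>" "real i * \<delta> < real (Suc j) * \<delta>" using i by auto
      then have "j = i" using \<open>0 < \<delta>\<close> by (simp only: mult_less_cancel_right_pos of_nat_less_iff)
      with True show ?thesis by (simp add: u_def)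
    next
      case False
      with i have "j \<noteq> i" by auto
      with False show ?thesis by (auto simp: u_def)
    qed
    have "v s = (\<Sum>j<N. if j = i then P (N - 1 - j) (\<sigma> s) else 0)"
      unfolding v_def uj by (intro sum.cong refl) (simp add: linear_0[OF linP])
    also have "\<dots> = P (N - 1 - i) (\<sigma> s)" using i(1) by simp
    finally have "(norm (v s))\<^sup>2 \<le> \<rho> ^ (N - 1 - i) * (norm (\<sigma> s))\<^sup>2" using nP by simp
    also have "\<dots> \<le> \<rho> ^ (N - 1 - i) * c\<^sup>2" using that \<rho>0 by (intro mult_left_mono power_mono) auto
    also have "\<dots> = (\<Sum>j<N. if j = i then \<rho> ^ (N - 1 - j) * c\<^sup>2 else 0)" using i(1) by simp
    also have "\<dots> = (\<Sum>j<N. \<rho> ^ (N - 1 - j) * c\<^sup>2 * u j s)" unfolding uj by (intro sum.cong refl) simp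
    finally show ?thesis .
  qed
  have vm: "v \<in> borel_measurable ?L"
  proof -
    have "P m \<in> borel_measurable borel" for m
      by (intro borel_measurable_continuous_onI linear_continuous_on) (use linP linear_linear in blast)
    moreover have "(\<lambda>s. u j s *\<^sub>R \<sigma> s) \<in> borel_measurable ?L" for j
      using \<sigma> unfolding u_def t_def
      by (intro borel_measurable_scaleR measurable_restrict_space1[OF borel_measurable_indicator]) simp
    ultimately show ?thesis unfolding v_def by (intro borel_measurable_sum) (rule measurable_compose)
  qed
  have em: "emeasure ?L {real j * \<delta><..real (Suc j) * \<delta>} = ennreal \<delta>" if "j < N" for j
  proof -
    have "0 \<le> real j * \<delta>" "real (Suc j) * \<delta> \<le> t"
      using that \<open>0 < \<delta>\<close> by (auto simp: t_def intro!: mult_right_mono)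
    then have "{real j * \<delta><..real (Suc j) * \<delta>} \<subseteq> {0..t}" by auto
    then have "emeasure ?L {real j * \<delta><..real (Suc j) * \<delta>} = emeasure lborel {real j * \<delta><..real (Suc j) * \<delta>}"
      by (subst emeasure_restrict_space) auto
    also have "\<dots> = ennreal (real (Suc j) * \<delta> - real j * \<delta>)"
      using \<open>0 < \<delta>\<close> by (intro emeasure_lborel_Ioc mult_right_mono) auto
    finally show ?thesis by (simp add: algebra_simps)
  qed
  have "(\<integral>\<^sup>+\<omega>. ennreal ((norm (euler_sum f (\<lambda>\<tau>. I \<tau> \<omega>) \<delta> N))\<^sup>2) \<partial>M)
      = (\<integral>\<^sup>+\<omega>. ennreal ((norm (\<Sum>j\<in>J. Q j (I (\<tau> j) \<omega>)))\<^sup>2) \<partial>M)"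
    unfolding euler_sum_def P_def[symmetric] by (subst sumJ) (rule refl)
  also have "\<dots> \<le> (\<integral>\<^sup>+z. ennreal ((norm (\<Sum>j\<in>J. Q j (indicat_real {0..\<tau> j} (fst z) *\<^sub>R \<sigma> (fst z))))\<^sup>2) \<partial>(?L \<Otimes>\<^sub>M M))"
  proof (rule nn_integral_linear_sum_ito_le[OF _ _ _ \<tau>t g])
    show "finite J" by (simp add: J_def)
    show "linear (Q j)" for j
      by (cases j; cases "snd j") (auto simp: Q_def linP linear_compose_neg)
    show "has_ito_integral M F W (\<lambda>s \<omega>. \<sigma> s) (\<tau> j) (I (\<tau> j))" if "j \<in> J" for j
      using that ito by (auto simp: J_def \<tau>_def simp del: of_nat_Suc)
  qed
  also have "\<dots> = (\<integral>\<^sup>+z. ennreal ((norm (v (fst z)))\<^sup>2) \<partial>(?L \<Otimes>\<^sub>M M))"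
    by (intro nn_integral_cong) (auto simp: v space_pair_measure)
  also have "\<dots> = (\<integral>\<^sup>+s. (\<integral>\<^sup>+\<omega>. ennreal ((norm (v s))\<^sup>2) \<partial>M) \<partial>?L)"
    using nn_integral_fst[of "\<lambda>z. ennreal ((norm (v (fst z)))\<^sup>2)" ?L] vm by simp
  also have "\<dots> = (\<integral>\<^sup>+s. ennreal ((norm (v s))\<^sup>2) \<partial>?L)"
    by (simp add: emeasure_space_1)
  also have "\<dots> \<le> (\<integral>\<^sup>+s. (\<Sum>j<N. ennreal (\<rho> ^ (N - 1 - j) * c\<^sup>2) * indicator {real j * \<delta><..real (Suc j) * \<delta>} s) \<partial>?L)"
  proof (rule nn_integral_mono_AE)
    show "AE s in ?L. ennreal ((norm (v s))\<^sup>2) \<le>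
        (\<Sum>j<N. ennreal (\<rho> ^ (N - 1 - j) * c\<^sup>2) * indicator {real j * \<delta><..real (Suc j) * \<delta>} s)"
      using \<sigma>c unfolding t_def
    proof eventually_elim
      case (elim s)
      have "ennreal ((norm (v s))\<^sup>2) \<le> ennreal (\<Sum>j<N. \<rho> ^ (N - 1 - j) * c\<^sup>2 * u j s)"
        using vle[OF elim] by (rule ennreal_leI)
      also have "\<dots> = (\<Sum>j<N. ennreal (\<rho> ^ (N - 1 - j) * c\<^sup>2 * u j s))"
        using \<rho>0 by (intro sum_ennreal[symmetric]) (auto simp: u_def)
      also have "\<dots> = (\<Sum>j<N. ennreal (\<rho> ^ (N - 1 - j) * c\<^sup>2) * indicator {real j * \<delta><..real (Suc j) * \<delta>} s)"
        by (intro sum.cong refl) (auto simp: u_def indicator_def)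
      finally show ?case .
    qed
  qed
  also have "\<dots> = (\<Sum>j<N. ennreal (\<rho> ^ (N - 1 - j) * c\<^sup>2) * ennreal \<delta>)"
  proof -
    \<comment> \<open>Sets outside the sigma-algebra have \<open>emeasure\<close> 0 by convention,
      so a positive value proves measurability.\<close>
    have "{real j * \<delta><..real (Suc j) * \<delta>} \<in> sets ?L" if "j < N" for j
      using em[OF that] \<open>0 < \<delta>\<close> by (intro emeasure_neq_0_sets) simp
    then have "(\<integral>\<^sup>+s. (\<Sum>j<N. ennreal (\<rho> ^ (N - 1 - j) * c\<^sup>2) * indicator {real j * \<delta><..real (Suc j) * \<delta>} s) \<partial>?L)
        = (\<Sum>j<N. \<integral>\<^sup>+s. ennreal (\<rho> ^ (N - 1 - j) * c\<^sup>2) * indicator {real j * \<delta><..real (Suc j) * \<delta>} s \<partial>?L)"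
      by (intro nn_integral_sum borel_measurable_times_ennreal borel_measurable_const borel_measurable_indicator) blast
    also have "\<dots> = (\<Sum>j<N. ennreal (\<rho> ^ (N - 1 - j) * c\<^sup>2) * ennreal \<delta>)"
      using \<open>\<And>j. j < N \<Longrightarrow> _ \<in> sets ?L\<close> em by (intro sum.cong refl) (simp only: lessThan_iff nn_integral_cmult_indicator)
    finally show ?thesis .
  qed
  also have "\<dots> = ennreal (\<Sum>j<N. \<rho> ^ (N - 1 - j) * c\<^sup>2 * \<delta>)"
    using \<rho>0 \<open>0 < \<delta>\<close> by (subst sum_ennreal[symmetric]) (auto simp: ennreal_mult'')
  also have "(\<Sum>j<N. \<rho> ^ (N - 1 - j) * c\<^sup>2 * \<delta>) = c\<^sup>2 * \<delta> * (\<Sum>j<N. \<rho> ^ j)"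
  proof -
    have "(\<Sum>j<N. \<rho> ^ (N - 1 - j)) = (\<Sum>j<N. \<rho> ^ j)"
      using sum.nat_diff_reindex[of "\<lambda>j. \<rho> ^ j" N] by simp
    then show ?thesis unfolding sum_distrib_right[symmetric] by (simp only: mult_ac)
  qed
  finally show ?thesis unfolding \<rho>_def .
qed

text \<open>The moment bound on the Euler sums is uniform for fine meshes, and Fatou's lemma carries
  it along their almost sure convergence to \<open>Y t\<close>. Integrability of \<open>Y\<close> is
  thus a consequence.\<close>

lemma dissipative_linear_sde_second_moment:
  fixes f :: "'b::euclidean_space \<Rightarrow> 'b" and \<sigma> :: "real \<Rightarrow> 'b"
  assumes "linear f" and diss: "\<And>x. x \<bullet> f x \<le> - k * (norm x)\<^sup>2" and "0 < k"
    and sde: "has_stochastic_differential M F W r 0 b (\<lambda>s \<omega>. \<sigma> s) Y"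
    and b: "\<And>s \<omega>. s \<in> {0..r} \<Longrightarrow> \<omega> \<in> space M \<Longrightarrow> b s \<omega> = f (Y s \<omega>)"
    and \<sigma>: "\<sigma> \<in> borel_measurable (lebesgue_on {0..r})"
    and \<sigma>c: "AE s in lebesgue_on {0..r}. norm (\<sigma> s) \<le> c" and "0 \<le> c"
    and t: "t \<in> {0..r}"
  shows "(\<integral>\<^sup>+\<omega>. ennreal ((norm (Y t \<omega>))\<^sup>2) \<partial>M) \<le> ennreal (c\<^sup>2 / (2 * k))"
\<comment> \<open>At \<open>t = 0\<close> the mesh \<open>t / N\<close> would be 0, while the
  isometry estimate is for positive mesh.\<close>
proof (cases "t = 0")
  case True
  have "AE \<omega> in M. Y 0 \<omega> = 0" using sde by (simp add: has_stochastic_differential_def)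
  then have "(\<integral>\<^sup>+\<omega>. ennreal ((norm (Y t \<omega>))\<^sup>2) \<partial>M) = (\<integral>\<^sup>+\<omega>. 0 \<partial>M)"
    unfolding True by (intro nn_integral_cong_AE) (auto elim: eventually_mono)
  then show ?thesis by simp
next
  case False
  with t have t0: "0 < t" "t \<le> r" by auto
  obtain L where L: "0 < L" "\<And>x. norm (f x) \<le> L * norm x"
    using linear_bounded_pos[OF \<open>linear f\<close>] by blast
  have "\<forall>\<tau>\<in>{0..r}. \<exists>I. has_ito_integral M F W (\<lambda>s \<omega>. \<sigma> s) \<tau> I \<and>
        (AE \<omega> in M. Y \<tau> \<omega> = Y 0 \<omega> + integral {0..\<tau>} (\<lambda>s. b s \<omega>) + I \<omega>)"
    using sde by (simp add: has_stochastic_differential_def)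
  from bchoice[OF this] obtain I where "\<forall>\<tau>\<in>{0..r}. has_ito_integral M F W (\<lambda>s \<omega>. \<sigma> s) \<tau> (I \<tau>) \<and>
        (AE \<omega> in M. Y \<tau> \<omega> = Y 0 \<omega> + integral {0..\<tau>} (\<lambda>s. b s \<omega>) + I \<tau> \<omega>)" ..
  then have I: "\<And>\<tau>. \<tau> \<in> {0..r} \<Longrightarrow> has_ito_integral M F W (\<lambda>s \<omega>. \<sigma> s) \<tau> (I \<tau>)"
    and YI: "\<And>\<tau>. \<tau> \<in> {0..r} \<Longrightarrow> AE \<omega> in M. Y \<tau> \<omega> = Y 0 \<omega> + integral {0..\<tau>} (\<lambda>s. b s \<omega>) + I \<tau> \<omega>"
    by blast+
  have grid: "real j * (t / real N) \<in> {0..r}" if "0 < N" "j \<le> N" for j N :: nat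
  proof -
    have "real j * (t / real N) \<le> real N * (t / real N)" using that t0 by (intro mult_right_mono) auto
    then show ?thesis using that t0 by simp
  qed
  define X where "X N \<omega> = euler_sum f (\<lambda>\<tau>. I \<tau> \<omega>) (t / real N) N" for N \<omega>
  \<comment> \<open>The geometric series contributes at most
    \<open>\<delta> / (1 - \<rho>) = 1 / (2 * k - L\<^sup>2 * \<delta>)\<close> with
    \<open>\<delta> = t / N\<close>; the denominator is positive once \<open>N\<close> is
    large.\<close>
  define \<beta> where "\<beta> N = c\<^sup>2 / (2 * k - L\<^sup>2 * (t / real N))" for N
  \<comment> \<open>One null set for all grids: there are countably many pairs \<open>N\<close>,
    \<open>j\<close>, so the choice of a version at every single time does no harm.\<close>
  have "AE \<omega> in M. \<forall>N j. 0 < N \<longrightarrow> j \<le> N \<longrightarrow> Y (real j * (t / real N)) \<omega> =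
      Y 0 \<omega> + integral {0..real j * (t / real N)} (\<lambda>s. b s \<omega>) + I (real j * (t / real N)) \<omega>"
    unfolding AE_all_countable using YI grid by (intro allI AE_impI) auto
  moreover have "AE \<omega> in M. continuous_on {0..r} (\<lambda>t. Y t \<omega>)" "AE \<omega> in M. Y 0 \<omega> = 0"
    using sde by (simp_all add: has_stochastic_differential_def)
  ultimately have lim: "AE \<omega> in M. (\<lambda>N. X N \<omega>) \<longlonglongrightarrow> Y t \<omega>"
    using AE_space
  proof eventually_elim
    case (elim \<omega>)
    show ?case unfolding X_def
    proof (rule euler_sum_tendsto[OF \<open>linear f\<close> t0(1)])
      show "continuous_on {0..t} (\<lambda>t. Y t \<omega>)" by (rule continuous_on_subset[OF elim(2)]) (use t0 in auto)
      fix N j :: nat assume Nj: "0 < N" "j \<le> N"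
      have "integral {0..real j * (t / real N)} (\<lambda>s. b s \<omega>) = integral {0..real j * (t / real N)} (\<lambda>s. f (Y s \<omega>))"
        by (intro Henstock_Kurzweil_Integration.integral_cong b) (use elim(4) grid[OF Nj] in auto)
      then show "Y (real j * (t / real N)) \<omega> = integral {0..real j * (t / real N)} (\<lambda>s. f (Y s \<omega>)) + I (real j * (t / real N)) \<omega>"
        using elim Nj by simp
    qed (use elim in auto)
  qed
  have "(\<lambda>N. 2 * k - L\<^sup>2 * (t / real N)) \<longlonglongrightarrow> 2 * k - L\<^sup>2 * 0"
    by (intro tendsto_diff tendsto_mult tendsto_const lim_const_over_n)
  then have den: "(\<lambda>N. 2 * k - L\<^sup>2 * (t / real N)) \<longlonglongrightarrow> 2 * k" by simp
  then have \<beta>: "\<beta> \<longlonglongrightarrow> c\<^sup>2 / (2 * k)"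
    unfolding \<beta>_def using \<open>0 < k\<close> by (intro tendsto_divide tendsto_const) auto
  have ev: "\<forall>\<^sub>F N in sequentially. (\<integral>\<^sup>+\<omega>. ennreal ((norm (X N \<omega>))\<^sup>2) \<partial>M) \<le> ennreal (\<beta> N)"
  proof -
    have "\<forall>\<^sub>F N in sequentially. 0 < 2 * k - L\<^sup>2 * (t / real N)"
      using order_tendstoD(1)[OF den, of 0] \<open>0 < k\<close> by simp
    then show ?thesis using eventually_gt_at_top[of 0]
    proof eventually_elim
      case (elim N)
      define \<delta> where "\<delta> = t / real N"
      define \<rho> where "\<rho> = 1 - 2 * k * \<delta> + L\<^sup>2 * \<delta>\<^sup>2"
      have \<delta>: "0 < \<delta>" "real N * \<delta> = t" using elim t0 by (auto simp: \<delta>_def)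
      have sub: "lebesgue_on {0..t} = restrict_space (lebesgue_on {0..r}) {0..t}"
        using t0 by (simp add: restrict_restrict_space Int_absorb1)
      have "(\<integral>\<^sup>+\<omega>. ennreal ((norm (X N \<omega>))\<^sup>2) \<partial>M) \<le> ennreal (c\<^sup>2 * \<delta> * (\<Sum>j<N. \<rho> ^ j))"
        unfolding X_def \<delta>_def[symmetric] \<rho>_def
      proof (rule nn_integral_euler_sum_le[OF \<open>linear f\<close> diss])
        show "\<sigma> \<in> borel_measurable (lebesgue_on {0..real N * \<delta>})"
          unfolding \<delta> sub using \<sigma> by (rule measurable_restrict_space1)
        show "AE s in lebesgue_on {0..real N * \<delta>}. norm (\<sigma> s) \<le> c"
          unfolding \<delta> sub using \<sigma>c t0
          by (subst AE_restrict_space_iff) (auto simp: sets_restrict_space_iff elim: eventually_mono)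
        show "has_ito_integral M F W (\<lambda>s \<omega>. \<sigma> s) (real j * \<delta>) (I (real j * \<delta>))" if "j \<le> N" for j
          using I grid[OF elim(2) that] by (simp add: \<delta>_def)
      qed (use L \<delta> \<open>0 \<le> c\<close> in auto)
      also have "c\<^sup>2 * \<delta> * (\<Sum>j<N. \<rho> ^ j) \<le> \<beta> N"
      proof -
        have \<rho>1: "1 - \<rho> = \<delta> * (2 * k - L\<^sup>2 * \<delta>)" by (simp add: \<rho>_def algebra_simps power2_eq_square)
        have pos: "0 < 2 * k - L\<^sup>2 * \<delta>" using elim by (simp add: \<delta>_def)
        with \<rho>1 \<delta> have "\<rho> < 1" by (metis diff_gt_0_iff_gt mult_pos_pos)
        have "0 \<le> \<rho>"
          using dissipative_euler_step(1)[OF diss _ L(2), of \<delta>] L(1) \<delta>(1) by (simp add: \<rho>_def)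
        have "(\<Sum>j<N. \<rho> ^ j) = (1 - \<rho> ^ N) / (1 - \<rho>)" using \<open>\<rho> < 1\<close> by (simp add: sum_gp_strict)
        also have "\<dots> \<le> 1 / (1 - \<rho>)" using \<open>\<rho> < 1\<close> \<open>0 \<le> \<rho>\<close> by (intro divide_right_mono) auto
        finally have "c\<^sup>2 * \<delta> * (\<Sum>j<N. \<rho> ^ j) \<le> c\<^sup>2 * \<delta> * (1 / (1 - \<rho>))"
          using \<delta>(1) by (intro mult_left_mono) auto
        also have "\<dots> = \<beta> N" unfolding \<rho>1 \<beta>_def \<delta>_def[symmetric] using \<delta>(1) pos by (simp add: field_simps)
        finally show ?thesis .
      qed
      finally show ?case by (simp add: ennreal_leI)
    qed
  qed
  have XM: "X N \<in> borel_measurable M" if "0 < N" for N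
  proof -
    have "I (real j * (t / real N)) \<in> borel_measurable M" if "j \<le> N" for j
      using I[OF grid[OF \<open>0 < N\<close> that]] by (simp add: has_ito_integral_def)
    moreover have "(\<lambda>v. v + (t / real N) *\<^sub>R f v) ^^ m \<in> borel_measurable borel" for m
      by (intro borel_measurable_continuous_onI linear_continuous_on)
        (use linear_funpow[OF linear_euler_step[OF \<open>linear f\<close>]] linear_linear in blast)
    ultimately show ?thesis unfolding X_def euler_sum_def
      by (intro borel_measurable_sum) (rule measurable_compose, auto intro!: borel_measurable_diff simp del: of_nat_Suc)
  qed
  \<comment> \<open>The shift to \<open>Suc N\<close> avoids the meaningless mesh
    \<open>t / 0\<close>, as Fatou's lemma wants every member of the sequence measurable.\<close>
  have "(\<integral>\<^sup>+\<omega>. ennreal ((norm (Y t \<omega>))\<^sup>2) \<partial>M) = (\<integral>\<^sup>+\<omega>. liminf (\<lambda>N. ennreal ((norm (X (Suc N) \<omega>))\<^sup>2)) \<partial>M)"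
  proof (rule nn_integral_cong_AE)
    show "AE \<omega> in M. ennreal ((norm (Y t \<omega>))\<^sup>2) = liminf (\<lambda>N. ennreal ((norm (X (Suc N) \<omega>))\<^sup>2))"
      using lim
    proof eventually_elim
      case (elim \<omega>)
      have "(\<lambda>N. ennreal ((norm (X (Suc N) \<omega>))\<^sup>2)) \<longlonglongrightarrow> ennreal ((norm (Y t \<omega>))\<^sup>2)"
        by (intro tendsto_ennrealI tendsto_power tendsto_norm LIMSEQ_Suc[OF elim])
      then show ?case by (intro lim_imp_Liminf[symmetric]) auto
    qed
  qed
  also have "\<dots> \<le> liminf (\<lambda>N. \<integral>\<^sup>+\<omega>. ennreal ((norm (X (Suc N) \<omega>))\<^sup>2) \<partial>M)"
    using XM by (intro nn_integral_liminf) simp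
  also have "\<dots> \<le> liminf (\<lambda>N. ennreal (\<beta> (Suc N)))"
    by (intro Liminf_mono eventually_compose_filterlim[OF ev filterlim_Suc])
  also have "\<dots> = ennreal (c\<^sup>2 / (2 * k))"
    by (intro lim_imp_Liminf tendsto_ennrealI LIMSEQ_Suc[OF \<beta>]) simp
  finally show ?thesis .
qed

end

section \<open>The feedback system\<close>

lemma Linfty_norm_AE:
  assumes "f \<in> Linfty I"
  shows "AE t in lebesgue_on I. norm (f t) \<le> Linfty_norm I f"
  using esssup_AE[of "\<lambda>t. ereal (norm (f t))" "lebesgue_on I"]
proof eventually_elim
  case (elim t)
  have "esssup (lebesgue_on I) (\<lambda>t. ereal (norm (f t))) < \<infinity>" using assms by (simp add: Linfty_def)
  with elim show ?case
    unfolding Linfty_norm_def by (cases "esssup (lebesgue_on I) (\<lambda>t. ereal (norm (f t)))") auto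
qed

theorem lemma12:
  fixes M :: "'a measure" and F :: "real \<Rightarrow> 'a measure" and W :: "real \<Rightarrow> 'a \<Rightarrow> real"
    and T h :: real
    and A S :: "real^'n^'n" and B Bbar :: "real^'m^'n" and K :: "nat \<Rightarrow> real^'n^'m"
    and \<sigma> :: "real \<Rightarrow> real^'n"
    and Y :: "nat \<Rightarrow> real \<Rightarrow> 'a \<Rightarrow> real^'n" and U :: "nat \<Rightarrow> real \<Rightarrow> 'a \<Rightarrow> real^'m"
  assumes "0 < h" and "h < T"
    and "wiener_process M F W"
    and "\<sigma> \<in> Linfty {0..T}"
    and "\<And>\<tau>. 0 < \<tau> \<Longrightarrow> \<tau> < T + h \<Longrightarrow> invertible (gramian A B \<tau> (T + h))"
    and "Bbar = matrix_exp (- h *\<^sub>R A) ** B"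
    and "\<And>k. 1 \<le> k \<Longrightarrow> normal_matrix (A - Bbar ** K k)"
    and "\<And>k. 1 \<le> k \<Longrightarrow> Max (Re ` matrix_spectrum (A - Bbar ** K k)) \<le> - real k"
    and "pos_semidef S"
    and "\<And>k. 1 \<le> k \<Longrightarrow> has_stochastic_differential M F W (T - h) 0
           (\<lambda>t \<omega>. A *v Y k t \<omega> + Bbar *v U k t \<omega>) (\<lambda>t \<omega>. \<sigma> t) (Y k)"
    and "\<And>k t \<omega>. 1 \<le> k \<Longrightarrow> t \<in> {0..T - h} \<Longrightarrow> \<omega> \<in> space M \<Longrightarrow>
           U k t \<omega> = - (K k *v Y k t \<omega>)"
  shows "\<forall>k\<ge>1. \<forall>t\<in>{0..T - h}.
    integrable M (\<lambda>\<omega>. Y k t \<omega> \<bullet> (S *v Y k t \<omega>)) \<and>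
    prob_space.expectation M (\<lambda>\<omega>. Y k t \<omega> \<bullet> (S *v Y k t \<omega>))
      \<le> onorm (\<lambda>x. S *v x) * (Linfty_norm {0..T} \<sigma>)\<^sup>2 / (2 * real k)"
proof (intro allI impI ballI)
  fix k :: nat and t assume k: "1 \<le> k" and t: "t \<in> {0..T - h}"
  interpret wiener_process M F W by fact
  define H where "H = A - Bbar ** K k"
  define c where "c = Linfty_norm {0..T} \<sigma>"
  have sde: "has_stochastic_differential M F W (T - h) 0
      (\<lambda>t \<omega>. A *v Y k t \<omega> + Bbar *v U k t \<omega>) (\<lambda>t \<omega>. \<sigma> t) (Y k)"
    using k assms(10) by blast
  have sub: "lebesgue_on {0..T - h} = restrict_space (lebesgue_on {0..T}) {0..T - h}"
    using \<open>0 < h\<close> by (simp add: restrict_restrict_space Int_absorb1)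
  have \<sigma>: "\<sigma> \<in> borel_measurable (lebesgue_on {0..T})"
    using assms(4) by (simp add: Linfty_def)
  \<comment> \<open>The absolute value supplies the nonnegative bound that the moment estimate asks
    for, and it disappears on squaring.\<close>
  have "AE s in lebesgue_on {0..T}. norm (\<sigma> s) \<le> \<bar>c\<bar>"
    using Linfty_norm_AE[OF assms(4)] by eventually_elim (simp add: c_def)
  then have \<sigma>c: "AE s in lebesgue_on {0..T - h}. norm (\<sigma> s) \<le> \<bar>c\<bar>"
    unfolding sub using \<open>0 < h\<close>
    by (subst AE_restrict_space_iff) (auto simp: sets_restrict_space_iff elim: eventually_mono)
  have "(\<integral>\<^sup>+\<omega>. ennreal ((norm (Y k t \<omega>))\<^sup>2) \<partial>M) \<le> ennreal (\<bar>c\<bar>\<^sup>2 / (2 * real k))"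
  proof (rule dissipative_linear_sde_second_moment[where f = "\<lambda>x. H *v x", OF _ _ _ sde _ _ \<sigma>c _ t])
    show "x \<bullet> (H *v x) \<le> - real k * (norm x)\<^sup>2" for x
      unfolding H_def using assms(7,8)[OF k] by (rule normal_matrix_dissipative)
    \<comment> \<open>Inserting the feedback closes the loop: the drift becomes linear in the state,
      with matrix \<open>H\<close>.\<close>
    show "A *v Y k s \<omega> + Bbar *v U k s \<omega> = H *v Y k s \<omega>" if "s \<in> {0..T - h}" "\<omega> \<in> space M" for s \<omega>
      using assms(11)[OF k that]
      by (simp add: H_def matrix_vector_mult_diff_rdistrib matrix_vector_mul_assoc[symmetric] linear_neg)
    show "\<sigma> \<in> borel_measurable (lebesgue_on {0..T - h})"
      unfolding sub using \<sigma> by (rule measurable_restrict_space1)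
  qed (use k in simp_all)
  then have nn: "(\<integral>\<^sup>+\<omega>. ennreal ((norm (Y k t \<omega>))\<^sup>2) \<partial>M) \<le> ennreal (c\<^sup>2 / (2 * real k))" by simp
  have Ym: "Y k t \<in> borel_measurable M"
  proof (rule measurable_F_M[of t])
    show "0 \<le> t" using t by simp
    show "Y k t \<in> borel_measurable (F t)" using sde t unfolding has_stochastic_differential_def by blast
  qed
  \<comment> \<open>The Bochner expectation of a non-integrable function is 0 by convention, so
    integrability must come from the \<open>ennreal\<close> bound before the expectation carries
    information.\<close>
  have int: "integrable M (\<lambda>\<omega>. (norm (Y k t \<omega>))\<^sup>2)"
    using Ym nn by (intro integrableI_bounded) (auto intro: le_less_trans)
  then have "ennreal (expectation (\<lambda>\<omega>. (norm (Y k t \<omega>))\<^sup>2)) \<le> ennreal (c\<^sup>2 / (2 * real k))"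
    using nn by (subst nn_integral_eq_integral[symmetric]) auto
  then have E: "expectation (\<lambda>\<omega>. (norm (Y k t \<omega>))\<^sup>2) \<le> c\<^sup>2 / (2 * real k)"
    by (subst (asm) ennreal_le_iff) auto
  have S: "\<bar>x \<bullet> (S *v x)\<bar> \<le> onorm (\<lambda>x. S *v x) * (norm x)\<^sup>2" for x
  proof -
    have "\<bar>x \<bullet> (S *v x)\<bar> \<le> norm x * norm (S *v x)" by (rule Cauchy_Schwarz_ineq2)
    also have "\<dots> \<le> norm x * (onorm (\<lambda>x. S *v x) * norm x)"
      by (intro mult_left_mono onorm matrix_vector_mul_bounded_linear norm_ge_zero)
    finally show ?thesis by (simp add: power2_eq_square mult_ac)
  qed
  have Sm: "(\<lambda>\<omega>. Y k t \<omega> \<bullet> (S *v Y k t \<omega>)) \<in> borel_measurable M"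
  proof -
    have "(\<lambda>x. x \<bullet> (S *v x)) \<in> borel_measurable borel"
      by (intro borel_measurable_continuous_onI continuous_on_inner continuous_on_id
          linear_continuous_on matrix_vector_mul_bounded_linear)
    then show ?thesis by (rule measurable_compose[OF Ym])
  qed
  have onn: "0 \<le> onorm (\<lambda>x. S *v x)" by (intro onorm_pos_le matrix_vector_mul_bounded_linear)
  have intS: "integrable M (\<lambda>\<omega>. Y k t \<omega> \<bullet> (S *v Y k t \<omega>))"
    by (rule Bochner_Integration.integrable_bound[OF integrable_mult_right[OF int, of "onorm (\<lambda>x. S *v x)"] Sm])
      (use S onn in simp)
  have "expectation (\<lambda>\<omega>. Y k t \<omega> \<bullet> (S *v Y k t \<omega>)) \<le> expectation (\<lambda>\<omega>. onorm (\<lambda>x. S *v x) * (norm (Y k t \<omega>))\<^sup>2)"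
    using S by (intro integral_mono intS integrable_mult_right int) (simp add: abs_le_iff)
  also have "\<dots> \<le> onorm (\<lambda>x. S *v x) * (c\<^sup>2 / (2 * real k))"
    using mult_left_mono[OF E onn] by simp
  finally show "integrable M (\<lambda>\<omega>. Y k t \<omega> \<bullet> (S *v Y k t \<omega>)) \<and>
      expectation (\<lambda>\<omega>. Y k t \<omega> \<bullet> (S *v Y k t \<omega>)) \<le> onorm (\<lambda>x. S *v x) * (Linfty_norm {0..T} \<sigma>)\<^sup>2 / (2 * real k)"
    using intS by (simp add: c_def)
qed

end
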